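(* Let $E,F$ be Banach spaces with $Z(E)$ and $Z(F)$ one-dimensional. (a) If $X,Y$ are realcompact completely regular spaces, $E,F$ are infinite-dimensional, and $T:C_b(X,E)\to C_b(Y,F)$ is a surjective linear isometry, then $T$ is a strong Banach-Stone map. (b) If $X,Y$ are complete metric spaces and $T:C_b^u(X,E)\to C_b^u(Y,F)$ is a surjective linear isometry, then $T$ is a uniform strong Banach-Stone map.
   Context: $\mathbb K=\mathbb R$ or $\mathbb C$; $E,F$ are $\mathbb K$-Banach spaces. $C_b(Z,G)$ is the space of bounded continuous $G$-valued functions and $C_b^u(Z,G)$ (for metric $Z$) of bounded uniformly continuous ones, with the sup norm. For a Banach space $W$, ${\rm Ext}_W$ is the set of extreme points of the closed unit ball of $W'$. A continuous linear $S:W\to W$ is a multiplier if there is $a_S:{\rm Ext}_W\to\mathbb K$ with $p\circ S=a_S(p)p$ for all $p\in{\rm Ext}_W$; $R$ is an adjoint of the multiplier $S$ if $a_R=\overline{a_S}$; the centralizer $Z(W)$ is the set of multipliers having an adjoint; one-dimensional means $Z(W)=\mathbb K\,\mathrm{Id}_W$. $I(E,F)$ is the set of surjective linear isometries $E\to F$ with the strong operator topology (coarsest topology making $S\mapsto S\mathbf e$ continuous for each $\mathbf e\in E$). A surjective linear isometry $T:A(X,E)\to A(Y,F)$ is a strong Banach-Stone map if there exist a continuous map $J:Y\to I(E,F)$ and a homeomorphism $h:Y\to X$ (onto) with $(Tf)(y)=(Jy)(f(h(y)))$ for all $f,y$; such a map between $C_b^u$ spaces is a uniform strong Banach-Stone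 map if moreover $h$ and $h^{-1}$ are uniformly continuous. *)

theory Defs
  imports "HOL-Analysis.Analysis"
begin

text \<open>Scalar field: a type 'k of class real_normed_field and banach, i.e. a complete
  commutative real normed field with multiplicative norm; such a field is (isometrically)
  the real or the complex numbers. A K-Banach space is a real Banach type 'e together
  with a K-scalar multiplication compatible with the real one and the norm.\<close>

definition kbanach :: "('k::{real_normed_field,banach} \<Rightarrow> 'e::banach \<Rightarrow> 'e) \<Rightarrow> bool" where
  "kbanach s \<longleftrightarrow> vector_space s \<and> (\<forall>a x. norm (s a x) = norm a * norm x)
     \<and> (\<forall>r x. s (of_real r) x = r *\<^sub>R x)"

text \<open>Conjugation on K: for K = R it is the identity, for K = C complex conjugation.\<close>
definition kconj :: "'k::real_normed_field \<Rightarrow> 'k" where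
  "kconj a = of_real ((norm a)\<^sup>2) / a"

definition dual_ball :: "('k::{real_normed_field,banach} \<Rightarrow> 'e::banach \<Rightarrow> 'e) \<Rightarrow> ('e \<Rightarrow> 'k) set" where
  "dual_ball s = {p. Vector_Spaces.linear s (*) p \<and> (\<forall>x. norm (p x) \<le> norm x)}"

definition Ext :: "('k::{real_normed_field,banach} \<Rightarrow> 'e::banach \<Rightarrow> 'e) \<Rightarrow> ('e \<Rightarrow> 'k) set" where
  "Ext s = {p \<in> dual_ball s. \<forall>q\<in>dual_ball s. \<forall>r\<in>dual_ball s. \<forall>t::real.
      0 < t \<and> t < 1 \<and> p = (\<lambda>x. t *\<^sub>R q x + (1 - t) *\<^sub>R r x) \<longrightarrow> q = r}"

definition multiplier :: "('k::{real_normed_field,banach} \<Rightarrow> 'e::banach \<Rightarrow> 'e) \<Rightarrow> ('e \<Rightarrow> 'e) \<Rightarrow> (('e \<Rightarrow> 'k) \<Rightarrow> 'k) \<Rightarrow> bool" where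
  "multiplier s S a \<longleftrightarrow> Vector_Spaces.linear s s S \<and> (\<exists>C. \<forall>x. norm (S x) \<le> C * norm x)
     \<and> (\<forall>p\<in>Ext s. \<forall>x. p (S x) = a p * p x)"

definition centralizer :: "('k::{real_normed_field,banach} \<Rightarrow> 'e::banach \<Rightarrow> 'e) \<Rightarrow> ('e \<Rightarrow> 'e) set" where
  "centralizer s = {S. \<exists>a. multiplier s S a \<and>
      (\<exists>R aR. multiplier s R aR \<and> (\<forall>p\<in>Ext s. aR p = kconj (a p)))}"

definition one_dim_centralizer :: "('k::{real_normed_field,banach} \<Rightarrow> 'e::banach \<Rightarrow> 'e) \<Rightarrow> bool" where
  "one_dim_centralizer s \<longleftrightarrow> centralizer s = {(\<lambda>x. s c x) | c. True} \<and> (\<exists>x::'e. x \<noteq> 0)"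

definition infinite_dim :: "('k::{real_normed_field,banach} \<Rightarrow> 'e::banach \<Rightarrow> 'e) \<Rightarrow> bool" where
  "infinite_dim s \<longleftrightarrow> \<not> (\<exists>B. finite B \<and> module.span s B = UNIV)"

text \<open>Realcompact: homeomorphic to a closed subspace of a product of real lines
  (indices can be taken among the real-valued functions on the space).\<close>
definition realcompact :: "'a topology \<Rightarrow> bool" where
  "realcompact X \<longleftrightarrow> (\<exists>(I::('a \<Rightarrow> real) set) S.
      closedin (product_topology (\<lambda>_. euclideanreal) I) S \<and>
      X homeomorphic_space subtopology (product_topology (\<lambda>_. euclideanreal) I) S)"

definition Cb :: "('x::topological_space \<Rightarrow> 'e::real_normed_vector) set" where
  "Cb = {f. continuous_on UNIV f \<and> bounded (range f)}"

definition Cbu :: "('x::metric_space \<Rightarrow> 'e::real_normed_vector) set" where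
  "Cbu = {f. uniformly_continuous_on UNIV f \<and> bounded (range f)}"

definition supnorm :: "('x \<Rightarrow> 'e::real_normed_vector) \<Rightarrow> real" where
  "supnorm f = (SUP x. norm (f x))"

definition surj_lin_isom ::
  "('k::{real_normed_field,banach} \<Rightarrow> 'e::banach \<Rightarrow> 'e) \<Rightarrow> ('k \<Rightarrow> 'f::banach \<Rightarrow> 'f) \<Rightarrow>
   ('x \<Rightarrow> 'e) set \<Rightarrow> ('y \<Rightarrow> 'f) set \<Rightarrow> (('x \<Rightarrow> 'e) \<Rightarrow> ('y \<Rightarrow> 'f)) \<Rightarrow> bool" where
  "surj_lin_isom sE sF A B T \<longleftrightarrow> T ` A = B
     \<and> (\<forall>f\<in>A. \<forall>g\<in>A. T (\<lambda>x. f x + g x) = (\<lambda>y. T f y + T g y))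
     \<and> (\<forall>c. \<forall>f\<in>A. T (\<lambda>x. sE c (f x)) = (\<lambda>y. sF c (T f y)))
     \<and> (\<forall>f\<in>A. supnorm (T f) = supnorm f)"

definition isoms :: "('k::{real_normed_field,banach} \<Rightarrow> 'e::banach \<Rightarrow> 'e) \<Rightarrow> ('k \<Rightarrow> 'f::banach \<Rightarrow> 'f) \<Rightarrow> ('e \<Rightarrow> 'f) set" where
  "isoms sE sF = {U. Vector_Spaces.linear sE sF U \<and> surj U \<and> (\<forall>x. norm (U x) = norm x)}"

text \<open>Strong Banach-Stone map (continuity of J into I(E,F) with the strong operator
  topology means continuity of y \<mapsto> J y e for every e).\<close>
definition strong_BS ::
  "('k::{real_normed_field,banach} \<Rightarrow> 'e::banach \<Rightarrow> 'e) \<Rightarrow> ('k \<Rightarrow> 'f::banach \<Rightarrow> 'f) \<Rightarrow>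
   ('x::topological_space \<Rightarrow> 'e) set \<Rightarrow> (('x \<Rightarrow> 'e) \<Rightarrow> ('y::topological_space \<Rightarrow> 'f)) \<Rightarrow> bool" where
  "strong_BS sE sF A T \<longleftrightarrow> (\<exists>(J::'y \<Rightarrow> 'e \<Rightarrow> 'f) (h::'y \<Rightarrow> 'x) g.
      (\<forall>y. J y \<in> isoms sE sF) \<and> (\<forall>e. continuous_on UNIV (\<lambda>y. J y e)) \<and>
      homeomorphism UNIV UNIV h g \<and>
      (\<forall>f\<in>A. \<forall>y. T f y = J y (f (h y))))"

definition uniform_strong_BS ::
  "('k::{real_normed_field,banach} \<Rightarrow> 'e::banach \<Rightarrow> 'e) \<Rightarrow> ('k \<Rightarrow> 'f::banach \<Rightarrow> 'f) \<Rightarrow>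
   ('x::metric_space \<Rightarrow> 'e) set \<Rightarrow> (('x \<Rightarrow> 'e) \<Rightarrow> ('y::metric_space \<Rightarrow> 'f)) \<Rightarrow> bool" where
  "uniform_strong_BS sE sF A T \<longleftrightarrow> (\<exists>(J::'y \<Rightarrow> 'e \<Rightarrow> 'f) (h::'y \<Rightarrow> 'x) g.
      (\<forall>y. J y \<in> isoms sE sF) \<and> (\<forall>e. continuous_on UNIV (\<lambda>y. J y e)) \<and>
      homeomorphism UNIV UNIV h g \<and>
      uniformly_continuous_on UNIV h \<and> uniformly_continuous_on UNIV g \<and>
      (\<forall>f\<in>A. \<forall>y. T f y = J y (f (h y))))"

end

theory Submission
  imports Defs "HOL-Library.Ramsey"
begin

text \<open>For a real function \<open>\<theta>\<close> with \<open>\<bar>\<theta>\<bar> \<le> 1\<close>, multiplication by \<open>\<theta>\<close> satisfies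
  \<open>\<parallel>u + \<theta> w\<parallel> \<le> max \<parallel>u + w\<parallel> \<parallel>u - w\<parallel>\<close>, hence so does its conjugate by \<open>T\<close>. The inequality
  forces the conjugate to act pointwise, by operators in the centralizer of \<open>F\<close>; so it is again
  a multiplication, and \<open>T (\<theta> f) y = ev y \<theta> * T f y\<close> for a character \<open>ev y\<close> of the real function
  algebra. Moreover \<open>\<parallel>T f y\<parallel> = ev y (\<lambda>x. \<parallel>f x\<parallel>)\<close>, so if \<open>ev y\<close> is evaluation at a point
  \<open>h y\<close> then \<open>T f y\<close> depends isometrically on \<open>f (h y)\<close> alone. It remains to see that every \<open>ev y\<close>
  is a point evaluation. For realcompact spaces a character failing this kills some \<open>u > 0\<close>, which
  the noncompactness of the unit ball of \<open>F\<close> excludes; for complete metric spaces the point is the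
  limit of a sequence on which the transform of \<open>dist y\<close> tends to zero.\<close>

text \<open>The norm alone does not see points: scalar \<open>Cb\<close> over the natural numbers
  and over their Stone-Cech compactification are isometric, though both spaces are realcompact and
  not homeomorphic. So the isometry first yields only an ideal point for each \<open>y\<close>,
  represented by the character \<open>ev y\<close>; no compactification is built. In (a) infinite
  dimension removes the ideal points, because a bounded function can follow a path without cluster
  points there. Real multiplications are used because the inequality is convexity along the segment
  from \<open>u - w\<close> to \<open>u + w\<close>; it mentions sup norms only and so passes
  through \<open>T\<close>. Pointwise statements come from test functions that fill the gap
  \<open>M - norm (f x)\<close>: they never push the sum above \<open>M\<close>, but overshoot at
  \<open>y\<close> if the claim fails. The same device bounds \<open>norm (T f y)\<close> from
  above; equality needs the bound for the inverse too, which is why \<open>T\<close> and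
  \<open>T'\<close> enter symmetrically.\<close>

section \<open>Extreme functionals and the centralizer\<close>

lemma kbanach_linear_iff:
  assumes "kbanach s1" "kbanach s2"
  shows "Vector_Spaces.linear s1 s2 f \<longleftrightarrow> (\<forall>x y. f (x + y) = f x + f y) \<and> (\<forall>c x. f (s1 c x) = s2 c (f x))"
  using assms by (auto simp: kbanach_def Vector_Spaces.linear_iff)

lemma dual_ball_iff:
  fixes s :: "'k::{real_normed_field,banach} \<Rightarrow> 'e::banach \<Rightarrow> 'e"
  assumes "kbanach s"
  shows "p \<in> dual_ball s \<longleftrightarrow> (\<forall>x y. p (x + y) = p x + p y) \<and> (\<forall>c x. p (s c x) = c * p x)
    \<and> (\<forall>x. norm (p x) \<le> norm x)"
proof -
  have "vector_space ((*) :: 'k \<Rightarrow> 'k \<Rightarrow> 'k)"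
    by (rule vector_space_over_itself.vector_space_axioms)
  then show ?thesis
    using assms by (auto simp: dual_ball_def kbanach_def Vector_Spaces.linear_iff)
qed

lemma kbanach_of_real: "kbanach s \<Longrightarrow> s (of_real r) x = r *\<^sub>R x"
  and kbanach_norm: "kbanach s \<Longrightarrow> norm (s c x) = norm c * norm x"
  and kbanach_add_right: "kbanach s \<Longrightarrow> s c (x + y) = s c x + s c y"
  and kbanach_add_left: "kbanach s \<Longrightarrow> s (c + d) x = s c x + s d x"
  and kbanach_mult: "kbanach s \<Longrightarrow> s (c * d) x = s c (s d x)"
  by (auto simp: kbanach_def vector_space_def)

lemma kbanach_scaleR: "kbanach s \<Longrightarrow> s c (r *\<^sub>R x) = r *\<^sub>R s c x"
  by (simp add: mult.commute flip: kbanach_of_real kbanach_mult)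

lemma kconj_of_real: "kconj (of_real r) = of_real r"
  by (simp add: kconj_def power2_eq_square)

text \<open>The hypothesis on \<open>H\<close> says that \<open>p = p \<circ> (1 + H)/2 + p \<circ> (1 - H)/2\<close> splits the norm
  of \<open>p\<close> additively, so that for extreme \<open>p\<close> both summands are multiples of \<open>p\<close>.\<close>
lemma extreme_point_multiplier:
  fixes s :: "'k::{real_normed_field,banach} \<Rightarrow> 'e::banach \<Rightarrow> 'e"
  assumes s: "kbanach s"
    and add: "\<And>x y. H (x + y) = H x + H y" and scale: "\<And>c x. H (s c x) = s c (H x)"
    and H: "\<And>u w M. norm (u + w) \<le> M \<Longrightarrow> norm (u - w) \<le> M \<Longrightarrow> norm (u + H w) \<le> M"
    and p: "p \<in> Ext s"
  shows "\<exists>c::real. \<forall>x. p (H x) = of_real c * p x"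
proof -
  have pb: "p \<in> dual_ball s" using p by (simp add: Ext_def)
  have padd: "p (x + y) = p x + p y" and pscale: "p (s c x) = c * p x"
    and pnorm: "norm (p x) \<le> norm x" for x y c
    using pb s by (auto simp: dual_ball_iff)
  have pdiff: "p (x - y) = p x - p y" for x y
    by (metis add_diff_cancel diff_add_cancel padd)
  have Hdiff: "H (x - y) = H x - H y" for x y
    by (metis add_diff_cancel diff_add_cancel add)
  have pR: "p (r *\<^sub>R x) = r *\<^sub>R p x" for r x
    using pscale[of "of_real r" x] kbanach_of_real[OF s] by (simp add: scaleR_conv_of_real)
  have HR: "H (r *\<^sub>R x) = r *\<^sub>R H x" for r x
    using scale[of "of_real r" x] kbanach_of_real[OF s] by simp
  define q where "q = (\<lambda>x. p ((1/2) *\<^sub>R (x + H x)))"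
  define r where "r = (\<lambda>x. p ((1/2) *\<^sub>R (x - H x)))"
  have q: "q x = (1/2) *\<^sub>R (p x + p (H x))" and r: "r x = (1/2) *\<^sub>R (p x - p (H x))" for x
    by (simp_all add: q_def r_def pR padd pdiff)
  have qr: "q x + r x = p x" for x
    unfolding q r scaleR_add_right[symmetric] by (simp flip: scaleR_2)
  have qadd: "q (x + y) = q x + q y" and radd: "r (x + y) = r x + r y" for x y
    unfolding q r by (simp_all add: padd add scaleR_add_right scaleR_diff_right)
  have qscale: "q (s c x) = c * q x" and rscale: "r (s c x) = c * r x" for x c
    unfolding q r scale pscale by (simp_all add: scaleR_conv_of_real algebra_simps)
  \<comment> \<open>With \<open>u = (x + y)/2\<close> and \<open>w = (x - y)/2\<close> the vector
    \<open>u + H w\<close> is half of \<open>(x + H x) + (y - H y)\<close>, so one bound controls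
    \<open>q\<close> and \<open>r\<close> at independent arguments.\<close>
  have sum1: "norm (q x + r y) \<le> 1" if "norm x \<le> 1" "norm y \<le> 1" for x y
  proof -
    let ?u = "(1/2) *\<^sub>R (x + y)" and ?w = "(1/2) *\<^sub>R (x - y)"
    have "?u + ?w = x" "?u - ?w = y"
      by (simp_all flip: scaleR_add_right scaleR_diff_right scaleR_2)
    then have "norm (?u + H ?w) \<le> 1" using that by (intro H) auto
    moreover have "q x + r y = p (?u + H ?w)"
      unfolding q r by (simp add: padd pR HR Hdiff pdiff scaleR_add_right scaleR_diff_right)
    ultimately show ?thesis using pnorm order_trans by metis
  qed
  \<comment> \<open>Unimodular factors turn both values into their norms, so \<open>sum1\<close>
    bounds a sum of norms.\<close>
  define sg where "sg = (\<lambda>z::'k. if z = 0 then 1 else of_real (norm z) / z)"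
  have sg: "norm (sg z) = 1" "sg z * z = of_real (norm z)" for z
    by (auto simp: sg_def norm_divide)
  have sum2: "norm (q x) + norm (r y) \<le> 1" if "norm x \<le> 1" "norm y \<le> 1" for x y
  proof -
    have "norm (q (s (sg (q x)) x) + r (s (sg (r y)) y)) \<le> 1"
      using that by (intro sum1) (auto simp: kbanach_norm[OF s] sg)
    then show ?thesis
      by (simp add: qscale rscale sg flip: of_real_add)
  qed
  \<comment> \<open>\<alpha> is the dual norm of \<open>q\<close>, and \<open>sum2\<close> leaves at
    most \<open>1 - \<alpha>\<close> for \<open>r\<close>. Thus \<open>p\<close> is a convex
    combination of the two rescaled functionals, unless \<alpha> is 0 or 1 and one of them
    vanishes.\<close>
  define S where "S = (\<lambda>x. norm (q x)) ` cball 0 1"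
  define \<alpha> where "\<alpha> = Sup S"
  have ne: "S \<noteq> {}" unfolding S_def by simp
  have q0: "q 0 = 0" and r0: "r 0 = 0"
    using qadd[of 0 0] radd[of 0 0] by auto
  have bdd: "bdd_above S"
    unfolding S_def using sum2[of _ 0] r0 by (auto intro!: bdd_aboveI[of _ 1])
  have q\<alpha>1: "norm (q x) \<le> \<alpha>" if "norm x \<le> 1" for x
    unfolding \<alpha>_def using that by (intro cSup_upper bdd) (auto simp: S_def)
  have r\<alpha>1: "norm (r y) \<le> 1 - \<alpha>" if "norm y \<le> 1" for y
  proof -
    have "\<alpha> \<le> 1 - norm (r y)"
      unfolding \<alpha>_def using ne sum2[OF _ that] by (intro cSup_least) (auto simp: S_def algebra_simps)
    then show ?thesis by simp
  qed
  have scaled: "norm (l x) \<le> b * norm x"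
    if "\<And>x. norm x \<le> 1 \<Longrightarrow> norm (l x) \<le> b" "\<And>c x. l (s c x) = c * l x" "l 0 = 0"
    for l b and x :: 'e
  proof (cases "x = 0")
    case False
    have "l ((1 / norm x) *\<^sub>R x) = of_real (1 / norm x) * l x"
      using that(2)[of "of_real (1 / norm x)" x] by (simp only: kbanach_of_real[OF s])
    then have "norm (l x) / norm x \<le> b"
      using that(1)[of "(1 / norm x) *\<^sub>R x"] False by (simp add: norm_mult norm_divide)
    then show ?thesis using False by (simp add: field_simps)
  qed (use that in simp)
  have q\<alpha>: "norm (q x) \<le> \<alpha> * norm x" and r\<alpha>: "norm (r x) \<le> (1 - \<alpha>) * norm x" for x
    using scaled[of q \<alpha>, OF q\<alpha>1 qscale q0] scaled[of r "1 - \<alpha>", OF r\<alpha>1 rscale r0] by auto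
  have "0 \<le> \<alpha>" "\<alpha> \<le> 1" using q\<alpha>1[of 0] r\<alpha>1[of 0] q0 r0 by auto
  have "q x = of_real \<alpha> * p x" for x
  proof -
    consider "\<alpha> = 0" | "\<alpha> = 1" | "0 < \<alpha>" "\<alpha> < 1"
      using \<open>0 \<le> \<alpha>\<close> \<open>\<alpha> \<le> 1\<close> by fastforce
    then show ?thesis
    proof cases
      case 1 then show ?thesis using q\<alpha>[of x] by simp
    next
      case 2 then show ?thesis using r\<alpha>[of x] qr[of x] by simp
    next
      case 3
      let ?q = "\<lambda>x. (1/\<alpha>) *\<^sub>R q x" and ?r = "\<lambda>x. (1/(1-\<alpha>)) *\<^sub>R r x"
      have "?q \<in> dual_ball s" "?r \<in> dual_ball s"
        using 3 q\<alpha> r\<alpha> by (auto simp: dual_ball_iff[OF s] qadd radd qscale rscale scaleR_add_right field_simps)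
      moreover have "p = (\<lambda>x. \<alpha> *\<^sub>R ?q x + (1 - \<alpha>) *\<^sub>R ?r x)"
        using 3 qr by (auto simp: fun_eq_iff)
      ultimately have "?q = ?r"
        using p 3 unfolding Ext_def mem_Collect_eq by metis
      from fun_cong[OF this, of x] have "(1/(1-\<alpha>)) *\<^sub>R r x = (1/\<alpha>) *\<^sub>R q x" by simp
      then have "(1 - \<alpha>) *\<^sub>R (1/(1-\<alpha>)) *\<^sub>R r x = (1 - \<alpha>) *\<^sub>R (1/\<alpha>) *\<^sub>R q x" by simp
      then have "r x = ((1 - \<alpha>)/\<alpha>) *\<^sub>R q x" using 3 by simp
      then have "p x = (1 + (1 - \<alpha>)/\<alpha>) *\<^sub>R q x" using qr[of x] by (simp add: scaleR_add_left)
      also have "1 + (1 - \<alpha>)/\<alpha> = 1/\<alpha>" using 3 by (simp add: field_simps)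
      finally show ?thesis using 3 by (simp add: scaleR_conv_of_real)
    qed
  qed
  moreover have "p (H x) = 2 *\<^sub>R q x - p x" for x
    unfolding q by simp
  ultimately have "p (H x) = of_real (2 * \<alpha> - 1) * p x" for x
    by (simp add: algebra_simps scaleR_conv_of_real)
  then show ?thesis by blast
qed

text \<open>The multiplier values of \<open>H\<close> are real, hence fixed by \<open>kconj\<close>,
  so \<open>H\<close> is its own adjoint. Boundedness is the case \<open>u = 0\<close> of the
  inequality.\<close>

lemma one_dim_centralizer_scalar:
  fixes s :: "'k::{real_normed_field,banach} \<Rightarrow> 'e::banach \<Rightarrow> 'e"
  assumes s: "kbanach s" and one: "one_dim_centralizer s"
    and add: "\<And>x y. H (x + y) = H x + H y" and scale: "\<And>c x. H (s c x) = s c (H x)"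
    and H: "\<And>u w M. norm (u + w) \<le> M \<Longrightarrow> norm (u - w) \<le> M \<Longrightarrow> norm (u + H w) \<le> M"
  shows "\<exists>c. \<forall>x. H x = s c x"
proof -
  have "\<forall>p\<in>Ext s. \<exists>c::real. \<forall>x. p (H x) = of_real c * p x"
    using extreme_point_multiplier[OF s add scale H] by blast
  then obtain a :: "('e \<Rightarrow> 'k) \<Rightarrow> real" where a: "\<And>p x. p \<in> Ext s \<Longrightarrow> p (H x) = of_real (a p) * p x"
    by metis
  have "norm (H x) \<le> norm x" for x
    using H[of 0 x "norm x"] by simp
  then have "multiplier s H (\<lambda>p. of_real (a p))"
    unfolding multiplier_def kbanach_linear_iff[OF s s]
    using a add scale by (auto intro: exI[of _ 1])
  then have "H \<in> centralizer s"
    unfolding centralizer_def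
    by (auto intro!: exI[of _ "\<lambda>p. of_real (a p)"] exI[of _ H] simp: kconj_of_real)
  then show ?thesis using one by (auto simp: one_dim_centralizer_def)
qed

section \<open>Characters induced by an isometry\<close>

lemma max_zero_eq: "max 0 (t::real) = (1/2) * (t + \<bar>t\<bar>)"
  by (simp add: max_def)

text \<open>The point \<open>u + t w\<close> lies on the segment between \<open>u - w\<close> and
  \<open>u + w\<close>.\<close>

lemma convex_combination_bound:
  fixes u w :: "'v::real_normed_vector"
  assumes "norm (u + w) \<le> M" "norm (u - w) \<le> M" "\<bar>t\<bar> \<le> 1"
  shows "norm (u + t *\<^sub>R w) \<le> M"
proof -
  have "u + t *\<^sub>R w = ((1 + t)/2) *\<^sub>R (u + w) + ((1 - t)/2) *\<^sub>R (u - w)"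
  proof -
    have "((1 + t)/2) *\<^sub>R (u + w) + ((1 - t)/2) *\<^sub>R (u - w)
        = ((1 + t)/2 + (1 - t)/2) *\<^sub>R u + ((1 + t)/2 - (1 - t)/2) *\<^sub>R w"
      by (simp only: scaleR_add_left scaleR_diff_left scaleR_add_right scaleR_diff_right) simp
    moreover have "(1 + t)/2 + (1 - t)/2 = 1" "(1 + t)/2 - (1 - t)/2 = t" by (simp_all add: field_simps)
    ultimately show ?thesis by simp
  qed
  then have "norm (u + t *\<^sub>R w) \<le> norm (((1 + t)/2) *\<^sub>R (u + w)) + norm (((1 - t)/2) *\<^sub>R (u - w))"
    by (simp only: norm_triangle_ineq)
  also have "\<dots> \<le> ((1 + t)/2) * M + ((1 - t)/2) * M"
    using assms by (intro add_mono) (auto intro!: mult_left_mono)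
  finally show ?thesis by (simp add: field_simps)
qed

text \<open>Equality case of the triangle inequality: a test vector in the direction of
  \<open>z\<close> makes any excess over \<open>M\<close> visible.\<close>

lemma norm_add_multiple:
  fixes z :: "'v::real_normed_vector"
  assumes "z \<noteq> 0" "M \<ge> 0"
  shows "norm (M *\<^sub>R ((1 / norm z) *\<^sub>R z) + z) = M + norm z"
proof -
  have "M *\<^sub>R ((1 / norm z) *\<^sub>R z) + z = (M / norm z + 1) *\<^sub>R z"
    by (simp add: algebra_simps)
  then show ?thesis using assms by (simp add: field_simps)
qed

text \<open>Covers \<open>Cb\<close> and \<open>Cbu\<close> at once. \<open>R_coeff\<close> reverses
  \<open>A_mult\<close>: it recovers a scalar function from its multiple of a unit vector.\<close>

locale function_module =
  fixes s :: "'k::{real_normed_field,banach} \<Rightarrow> 'e::banach \<Rightarrow> 'e"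
    and R :: "('x \<Rightarrow> real) set" and A :: "('x \<Rightarrow> 'e) set"
  assumes kbanach: "kbanach s"
    and R_const: "(\<lambda>_. c) \<in> R"
    and R_add: "\<phi> \<in> R \<Longrightarrow> \<psi> \<in> R \<Longrightarrow> (\<lambda>x. \<phi> x + \<psi> x) \<in> R"
    and R_mult: "\<phi> \<in> R \<Longrightarrow> \<psi> \<in> R \<Longrightarrow> (\<lambda>x. \<phi> x * \<psi> x) \<in> R"
    and R_abs: "\<phi> \<in> R \<Longrightarrow> (\<lambda>x. \<bar>\<phi> x\<bar>) \<in> R"
    and R_bounded: "\<phi> \<in> R \<Longrightarrow> bounded (range \<phi>)"
    and A_bounded: "f \<in> A \<Longrightarrow> bounded (range f)"
    and A_const: "(\<lambda>_. e) \<in> A"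
    and A_add: "f \<in> A \<Longrightarrow> g \<in> A \<Longrightarrow> (\<lambda>x. f x + g x) \<in> A"
    and A_scale: "f \<in> A \<Longrightarrow> (\<lambda>x. s a (f x)) \<in> A"
    and A_mult: "\<phi> \<in> R \<Longrightarrow> f \<in> A \<Longrightarrow> (\<lambda>x. \<phi> x *\<^sub>R f x) \<in> A"
    and A_norm: "f \<in> A \<Longrightarrow> (\<lambda>x. norm (f x)) \<in> R"
    and R_coeff: "(\<lambda>x. \<phi> x *\<^sub>R e) \<in> A \<Longrightarrow> norm e = 1 \<Longrightarrow> \<phi> \<in> R"
begin

lemma R_diff: "\<phi> \<in> R \<Longrightarrow> \<psi> \<in> R \<Longrightarrow> (\<lambda>x. \<phi> x - \<psi> x) \<in> R"
  using R_add[of \<phi> "\<lambda>x. (-1) * \<psi> x"] R_mult[OF R_const[of "-1"], of \<psi>] by simp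

lemma R_scale: "\<phi> \<in> R \<Longrightarrow> (\<lambda>x. c * \<phi> x) \<in> R"
  using R_mult[OF R_const[of c], of \<phi>] by simp

lemma A_diff: "f \<in> A \<Longrightarrow> g \<in> A \<Longrightarrow> (\<lambda>x. f x - g x) \<in> A"
  using A_add[of f "\<lambda>x. (-1) *\<^sub>R g x"] A_mult[OF R_const[of "-1"], of g] by simp

lemma A_scaleR: "f \<in> A \<Longrightarrow> (\<lambda>x. c *\<^sub>R f x) \<in> A"
  by (rule A_mult[OF R_const])

lemma R_pos_part: "\<phi> \<in> R \<Longrightarrow> (\<lambda>x. max 0 (\<phi> x)) \<in> R"
  unfolding max_zero_eq by (intro R_scale R_add R_abs)

lemma R_bound: assumes "\<phi> \<in> R" obtains M where "M > 0" "\<And>x. \<bar>\<phi> x\<bar> \<le> M"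
  using R_bounded[OF assms] by (auto simp: bounded_pos)

lemma A_bound: assumes "f \<in> A" obtains M where "M > 0" "\<And>x. norm (f x) \<le> M"
  using A_bounded[OF assms] by (auto simp: bounded_pos)

end

text \<open>The isometry property is phrased by pointwise bounds, and the axioms are symmetric in
  \<open>T\<close> and \<open>T'\<close>, so each result can also be read for the inverse.\<close>

locale module_isometry = dom: function_module sE R A + cod: function_module sF Q B
  for sE :: "'k::{real_normed_field,banach} \<Rightarrow> 'e::banach \<Rightarrow> 'e"
    and R :: "('x \<Rightarrow> real) set" and A :: "('x \<Rightarrow> 'e) set"
    and sF :: "'k \<Rightarrow> 'f::banach \<Rightarrow> 'f"
    and Q :: "('y \<Rightarrow> real) set" and B :: "('y \<Rightarrow> 'f) set" +
  fixes T :: "('x \<Rightarrow> 'e) \<Rightarrow> ('y \<Rightarrow> 'f)" and T' :: "('y \<Rightarrow> 'f) \<Rightarrow> ('x \<Rightarrow> 'e)"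
  assumes one_dim_dom: "one_dim_centralizer sE" and one_dim_cod: "one_dim_centralizer sF"
    and T_mem: "f \<in> A \<Longrightarrow> T f \<in> B" and T'_mem: "g \<in> B \<Longrightarrow> T' g \<in> A"
    and T'_T: "f \<in> A \<Longrightarrow> T' (T f) = f" and T_T': "g \<in> B \<Longrightarrow> T (T' g) = g"
    and T_add: "f \<in> A \<Longrightarrow> f' \<in> A \<Longrightarrow> T (\<lambda>x. f x + f' x) = (\<lambda>y. T f y + T f' y)"
    and T_scale: "f \<in> A \<Longrightarrow> T (\<lambda>x. sE c (f x)) = (\<lambda>y. sF c (T f y))"
    and T_bound: "f \<in> A \<Longrightarrow> (\<And>x. norm (f x) \<le> M) \<Longrightarrow> norm (T f y) \<le> M"
    and T'_bound: "g \<in> B \<Longrightarrow> (\<And>y. norm (g y) \<le> M) \<Longrightarrow> norm (T' g x) \<le> M"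
begin

lemma inverse: "module_isometry sF Q B sE R A T' T"
proof unfold_locales
  fix f g assume fg: "f \<in> B" "g \<in> B"
  show "T' (\<lambda>x. f x + g x) = (\<lambda>y. T' f y + T' g y)"
    using T_add[of "T' f" "T' g"] fg T'_T[OF dom.A_add[of "T' f" "T' g"]] by (simp add: T'_mem T_T')
  show "T' (\<lambda>x. sF c (f x)) = (\<lambda>y. sE c (T' f y))" for c
    using T_scale[of "T' f" c] fg T'_T[OF dom.A_scale[of "T' f" c]] by (simp add: T'_mem T_T')
qed (fact one_dim_dom one_dim_cod T_mem T'_mem T'_T T_T' T_bound T'_bound)+

lemma T_scaleR: "f \<in> A \<Longrightarrow> T (\<lambda>x. c *\<^sub>R f x) = (\<lambda>y. c *\<^sub>R T f y)"
  using T_scale[of f "of_real c"] kbanach_of_real[OF dom.kbanach] kbanach_of_real[OF cod.kbanach] by simp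

lemma T_diff: "f \<in> A \<Longrightarrow> g \<in> A \<Longrightarrow> T (\<lambda>x. f x - g x) = (\<lambda>y. T f y - T g y)"
  using T_add[of f "\<lambda>x. (-1) *\<^sub>R g x"] T_scaleR[of g "-1"] dom.A_scaleR[of g "-1"] by simp

lemma T'_add: "f \<in> B \<Longrightarrow> g \<in> B \<Longrightarrow> T' (\<lambda>x. f x + g x) = (\<lambda>y. T' f y + T' g y)"
  and T'_scale: "f \<in> B \<Longrightarrow> T' (\<lambda>x. sF c (f x)) = (\<lambda>y. sE c (T' f y))"
  and T'_diff: "f \<in> B \<Longrightarrow> g \<in> B \<Longrightarrow> T' (\<lambda>x. f x - g x) = (\<lambda>y. T' f y - T' g y)"
proof -
  interpret inv: module_isometry sF Q B sE R A T' T by (rule inverse)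
  show "f \<in> B \<Longrightarrow> g \<in> B \<Longrightarrow> T' (\<lambda>x. f x + g x) = (\<lambda>y. T' f y + T' g y)"
    and "f \<in> B \<Longrightarrow> T' (\<lambda>x. sF c (f x)) = (\<lambda>y. sE c (T' f y))"
    and "f \<in> B \<Longrightarrow> g \<in> B \<Longrightarrow> T' (\<lambda>x. f x - g x) = (\<lambda>y. T' f y - T' g y)"
    by (fact inv.T_add inv.T_scale inv.T_diff)+
qed

text \<open>Both hypotheses on \<open>u\<close> and \<open>w\<close> survive \<open>T'\<close>;
  there convexity applies at each point, and \<open>T\<close> carries the bound back.\<close>

lemma T_mult_bound:
  assumes \<theta>: "\<theta> \<in> R" "\<And>x. \<bar>\<theta> x\<bar> \<le> 1" and uw: "u \<in> B" "w \<in> B"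
    and M: "\<And>y. norm (u y + w y) \<le> M" "\<And>y. norm (u y - w y) \<le> M"
  shows "norm (u y + T (\<lambda>x. \<theta> x *\<^sub>R T' w x) y) \<le> M"
proof -
  have mem: "T' u \<in> A" "(\<lambda>x. \<theta> x *\<^sub>R T' w x) \<in> A" using \<theta> uw by (auto intro: T'_mem dom.A_mult)
  have "norm (T' u x + T' w x) \<le> M" "norm (T' u x - T' w x) \<le> M" for x
    using T'_bound[OF cod.A_add[OF uw] M(1), of x] T'_bound[OF cod.A_diff[OF uw] M(2), of x] uw
    by (simp_all add: T'_add T'_diff)
  then have "norm (T' u x + \<theta> x *\<^sub>R T' w x) \<le> M" for x
    using \<theta>(2) by (intro convex_combination_bound) auto
  from T_bound[OF dom.A_add[OF mem] this, of y] show ?thesis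
    using uw mem by (simp add: T_add T_T')
qed

text \<open>The test function \<open>u\<close> has height \<open>M - norm (w y')\<close> at each
  \<open>y'\<close>, so it is admissible in \<open>T_mult_bound\<close>. As \<open>w\<close>
  vanishes at \<open>y\<close>, it has full height \<open>M\<close> there, and adding a nonzero
  value in the same direction exceeds \<open>M\<close>.\<close>

lemma T_mult_local:
  assumes \<theta>: "\<theta> \<in> R" "\<And>x. \<bar>\<theta> x\<bar> \<le> 1" and f: "f \<in> A" and y: "T f y = 0"
  shows "T (\<lambda>x. \<theta> x *\<^sub>R f x) y = 0"
proof (rule ccontr)
  let ?z = "T (\<lambda>x. \<theta> x *\<^sub>R f x) y"
  assume z: "?z \<noteq> 0"
  define w where "w = T f"
  have w: "w \<in> B" "T' w = f" using f by (simp_all add: w_def T_mem T'_T)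
  obtain M where M: "M > 0" "\<And>y. norm (w y) \<le> M" using cod.A_bound[OF w(1)] by blast
  define e where "e = (1 / norm ?z) *\<^sub>R ?z"
  have e: "norm e = 1" using z by (simp add: e_def)
  define u where "u = (\<lambda>y. (M - norm (w y)) *\<^sub>R e)"
  have u: "u \<in> B"
    unfolding u_def by (intro cod.A_mult cod.R_diff cod.R_const cod.A_norm w cod.A_const)
  have nu: "norm (u y) = M - norm (w y)" for y using M(2)[of y] e by (simp add: u_def)
  have "norm (u y + T (\<lambda>x. \<theta> x *\<^sub>R T' w x) y) \<le> M"
  proof (rule T_mult_bound[OF \<theta> u w(1)])
    show "norm (u y + w y) \<le> M" "norm (u y - w y) \<le> M" for y
      using norm_triangle_ineq[of "u y" "w y"] norm_triangle_ineq4[of "u y" "w y"] nu[of y] by simp_all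
  qed
  moreover have "u y = M *\<^sub>R ((1 / norm ?z) *\<^sub>R ?z)" using y by (simp add: u_def w_def e_def)
  ultimately have "M + norm ?z \<le> M"
    using norm_add_multiple[OF z, of M] M(1) w(2) by simp
  then show False using z by simp
qed

lemma ex_nonzero: "\<exists>f\<in>A. T f y \<noteq> 0"
proof -
  obtain e :: 'f where "e \<noteq> 0" using one_dim_cod by (auto simp: one_dim_centralizer_def)
  then show ?thesis
    by (intro bexI[of _ "T' (\<lambda>_. e)"]) (auto simp: T_T' T'_mem cod.A_const)
qed

text \<open>By locality the value at \<open>y\<close> depends on \<open>T f y\<close> only, so it
  can be computed on preimages of constants. This gives the operator \<open>H\<close> on the fibre,
  to which the centralizer lemma applies after scaling \<theta> to absolute value at most 1.\<close>

lemma T_mult_scalar: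
  assumes \<theta>: "\<theta> \<in> R"
  shows "\<exists>c. \<forall>f\<in>A. T (\<lambda>x. \<theta> x *\<^sub>R f x) y = sF c (T f y)"
proof -
  obtain M where M: "M > 0" "\<And>x. \<bar>\<theta> x\<bar> \<le> M" using dom.R_bound[OF \<theta>] by blast
  define \<eta> where "\<eta> = (\<lambda>x. (1/M) * \<theta> x)"
  have \<eta>: "\<eta> \<in> R" "\<And>x. \<bar>\<eta> x\<bar> \<le> 1"
    using M dom.R_scale[OF \<theta>, of "1/M"] by (simp_all add: \<eta>_def abs_mult)
  define H where "H = (\<lambda>e. T (\<lambda>x. \<eta> x *\<^sub>R T' (\<lambda>_. e) x) y)"
  have c: "T' (\<lambda>_. e) \<in> A" for e by (intro T'_mem cod.A_const)
  have mem: "(\<lambda>x. \<eta> x *\<^sub>R f x) \<in> A" if "f \<in> A" for f by (intro dom.A_mult \<eta> that)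
  have "H (a + b) = H a + H b" for a b
    unfolding H_def T'_add[OF cod.A_const cod.A_const]
    using fun_cong[OF T_add[OF mem[OF c[of a]] mem[OF c[of b]]], of y] by (simp add: scaleR_add_right)
  moreover have "H (sF k e) = sF k (H e)" for k e
    unfolding H_def T'_scale[OF cod.A_const]
    using fun_cong[OF T_scale[OF mem[OF c[of e]], of k], of y] by (simp add: kbanach_scaleR[OF dom.kbanach])
  moreover have "norm (u + H w) \<le> M'" if "norm (u + w) \<le> M'" "norm (u - w) \<le> M'" for u w M'
    unfolding H_def using T_mult_bound[OF \<eta> cod.A_const cod.A_const, of u w M'] that by simp
  ultimately obtain k where k: "\<And>e. H e = sF k e"
    using one_dim_centralizer_scalar[OF cod.kbanach one_dim_cod, of H] by blast
  have "T (\<lambda>x. \<theta> x *\<^sub>R f x) y = sF (of_real M * k) (T f y)" if f: "f \<in> A" for f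
  proof -
    define e where "e = T f y"
    have d: "(\<lambda>x. f x - T' (\<lambda>_. e) x) \<in> A" by (intro dom.A_diff f c)
    have "T (\<lambda>x. \<eta> x *\<^sub>R (f x - T' (\<lambda>_. e) x)) y = 0"
      by (rule T_mult_local[OF \<eta> d]) (simp add: T_diff f c T_T' cod.A_const e_def)
    then have "T (\<lambda>x. \<eta> x *\<^sub>R f x) y = H e"
      using T_diff[OF mem[OF f] mem[OF c[of e]]] by (simp add: H_def scaleR_diff_right)
    moreover have "T (\<lambda>x. M *\<^sub>R \<eta> x *\<^sub>R f x) y = M *\<^sub>R T (\<lambda>x. \<eta> x *\<^sub>R f x) y"
      using T_scaleR[OF mem[OF f], of M] by simp
    ultimately show ?thesis
      using M(1) kbanach_of_real[OF cod.kbanach] kbanach_mult[OF cod.kbanach] by (simp add: \<eta>_def k e_def)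
  qed
  then show ?thesis by blast
qed

text \<open>A multiplicative map from a function algebra into a field is real: as
  \<open>(\<theta> - r)\<^sup>+ (\<theta> - r)\<^sup>- = 0\<close>, every real \<open>r\<close> is classified as lying below or above the value of
  \<open>\<theta>\<close>, and this defines a Dedekind cut.\<close>
lemma T_mult_real:
  assumes \<theta>: "\<theta> \<in> R"
  shows "\<exists>c::real. \<forall>f\<in>A. T (\<lambda>x. \<theta> x *\<^sub>R f x) y = c *\<^sub>R T f y"
proof -
  obtain k where k: "\<And>\<phi> f. \<phi> \<in> R \<Longrightarrow> f \<in> A \<Longrightarrow> T (\<lambda>x. \<phi> x *\<^sub>R f x) y = sF (k \<phi>) (T f y)"
    using T_mult_scalar[of _ y] by metis
  \<comment> \<open>A nonzero value \<open>e\<close> serves as probe: identities for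
    \<open>k\<close> are read off from the action of scalars on it.\<close>
  obtain e :: 'f where "e \<noteq> 0" using one_dim_cod by (auto simp: one_dim_centralizer_def)
  define f where "f = T' (\<lambda>_. e)"
  have f: "f \<in> A" "T f y = e" by (simp_all add: f_def T'_mem T_T' cod.A_const)
  have fb: "norm (f x) \<le> norm e" for x unfolding f_def by (intro T'_bound cod.A_const) simp
  have inj: "a = b" if "sF a e = sF b e" for a b
  proof -
    have "sF (a - b) e + sF b e = sF a e" by (simp flip: kbanach_add_left[OF cod.kbanach])
    then have "norm (a - b) * norm e = 0" using that kbanach_norm[OF cod.kbanach, of "a - b" e] by simp
    then show ?thesis using \<open>e \<noteq> 0\<close> by simp
  qed
  have k_bound: "norm (k \<phi>) \<le> b" if "\<phi> \<in> R" "\<And>x. \<bar>\<phi> x\<bar> \<le> b" for \<phi> b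
  proof -
    have "b \<ge> 0" using that(2) abs_ge_zero order_trans by blast
    have "norm (T (\<lambda>x. \<phi> x *\<^sub>R f x) y) \<le> b * norm e"
      using that fb \<open>b \<ge> 0\<close> by (intro T_bound dom.A_mult f) (auto intro!: mult_mono)
    then show ?thesis using that f \<open>e \<noteq> 0\<close> by (simp add: k kbanach_norm[OF cod.kbanach])
  qed
  have k_const: "k (\<lambda>_. r) = of_real r" for r
    using k[OF dom.R_const f(1), of r] T_scaleR[OF f(1), of r] f(2)
    by (intro inj) (simp add: kbanach_of_real[OF cod.kbanach])
  have k_add: "k (\<lambda>x. \<phi> x + \<psi> x) = k \<phi> + k \<psi>" if "\<phi> \<in> R" "\<psi> \<in> R" for \<phi> \<psi>
    using k[OF dom.R_add[OF that] f(1)] k[OF that(1) f(1)] k[OF that(2) f(1)] f(2)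
      T_add[OF dom.A_mult[OF that(1) f(1)] dom.A_mult[OF that(2) f(1)]]
    by (intro inj) (simp add: kbanach_add_left[OF cod.kbanach] scaleR_add_left)
  have k_mult: "k (\<lambda>x. \<phi> x * \<psi> x) = k \<phi> * k \<psi>" if "\<phi> \<in> R" "\<psi> \<in> R" for \<phi> \<psi>
    using k[OF dom.R_mult[OF that] f(1)] k[OF that(2) f(1)] f(2)
      k[OF that(1) dom.A_mult[OF that(2) f(1)]]
    by (intro inj) (simp add: kbanach_mult[OF cod.kbanach])
  have k_diff: "k (\<lambda>x. \<phi> x - \<psi> x) = k \<phi> - k \<psi>" if "\<phi> \<in> R" "\<psi> \<in> R" for \<phi> \<psi>
    using k_add[OF dom.R_diff[OF that] that(2)] by simp
  have Rr: "(\<lambda>x. \<theta> x - r) \<in> R" "(\<lambda>x. r - \<theta> x) \<in> R" for r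
    by (intro dom.R_diff \<theta> dom.R_const)+
  define pos where "pos = (\<lambda>r x. max 0 (\<theta> x - r))"
  define neg where "neg = (\<lambda>r x. max 0 (r - \<theta> x))"
  have pn: "pos r \<in> R" "neg r \<in> R" for r
    unfolding pos_def neg_def by (intro dom.R_pos_part Rr)+
  have zero: "k (pos r) = 0 \<or> k (neg r) = 0" for r
  proof -
    have "(\<lambda>x. pos r x * neg r x) = (\<lambda>_. 0)" by (auto simp: pos_def neg_def fun_eq_iff max_def)
    then show ?thesis using k_mult[OF pn, of r r] k_const[of 0] by simp
  qed
  have split: "k \<theta> - of_real r = k (pos r) - k (neg r)" for r
  proof -
    have "k (\<lambda>x. \<theta> x - r) = k (\<lambda>x. pos r x - neg r x)"
      by (rule arg_cong[of _ _ k]) (auto simp: pos_def neg_def fun_eq_iff max_def)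
    then show ?thesis using k_diff[OF \<theta> dom.R_const] k_diff[OF pn] by (simp add: k_const)
  qed
  obtain M where M: "M > 0" "\<And>x. \<bar>\<theta> x\<bar> \<le> M" using dom.R_bound[OF \<theta>] by blast
  \<comment> \<open>The lower half of the cut: for \<open>r\<close> in \<open>L\<close> the part of
    \<theta> below \<open>r\<close> is killed.\<close>
  define L where "L = {r. k (neg r) = 0}"
  have "- M \<in> L"
  proof -
    have "neg (- M) = (\<lambda>_. 0)" using M(2) by (simp add: neg_def max_absorb1 abs_le_iff minus_le_iff)
    then show ?thesis by (simp add: L_def k_const[of 0])
  qed
  have "r \<le> M" if "r \<in> L" for r
  proof (rule ccontr)
    assume "\<not> r \<le> M"
    then have "\<theta> x \<le> r" for x using M(2)[of x] by simp
    then have "pos r = (\<lambda>_. 0)" by (simp add: pos_def max_absorb1)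
    then have "k \<theta> = of_real r" using split[of r] that k_const[of 0] by (simp add: L_def)
    then show False using k_bound[OF \<theta> M(2)] \<open>\<not> r \<le> M\<close> by simp
  qed
  then have bdd: "bdd_above L" by (rule bdd_aboveI)
  define c where "c = Sup L"
  \<comment> \<open>The points \<open>r\<close> and \<open>r'\<close> enclose \<open>c\<close>
    within \<open>2 * \<epsilon>\<close>, and moving from \<open>r\<close> to \<open>c\<close> costs
    another \<epsilon>.\<close>
  have close: "norm (k \<theta> - of_real c) \<le> 3 * \<epsilon>" if "\<epsilon> > 0" for \<epsilon>
  proof -
    have "Sup L - \<epsilon> < Sup L" using that by simp
    then obtain r where "r \<in> L" "Sup L - \<epsilon> < r" using \<open>- M \<in> L\<close> less_cSupE by blast
    then have r: "r \<in> L" "c - \<epsilon> < r" "r \<le> c" using cSup_upper[OF _ bdd] by (simp_all add: c_def)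
    define r' where "r' = c + \<epsilon>"
    have "r' \<notin> L" using cSup_upper[OF _ bdd, of r'] that by (auto simp: c_def r'_def)
    then have "k (pos r') = 0" using zero by (auto simp: L_def)
    then have "k \<theta> - of_real r = k (\<lambda>x. pos r x - pos r' x)"
      using split[of r] r(1) k_diff[OF pn(1) pn(1)] by (simp add: L_def)
    also have "norm \<dots> \<le> r' - r"
      using r that by (intro k_bound dom.R_diff pn) (auto simp: pos_def r'_def max_def)
    finally have "norm (k \<theta> - of_real r) \<le> 2 * \<epsilon>" using r by (simp add: r'_def)
    moreover have "norm (of_real r - of_real c :: 'k) \<le> \<epsilon>"
      using r by (simp flip: of_real_diff)
    ultimately show ?thesis
      using norm_triangle_ineq[of "k \<theta> - of_real r" "of_real r - of_real c"] by simp
  qed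
  have "norm (k \<theta> - of_real c) \<le> 0"
  proof (rule field_le_epsilon)
    fix d :: real assume "d > 0" then show "norm (k \<theta> - of_real c) \<le> 0 + d" using close[of "d/3"] by simp
  qed
  then have "k \<theta> = of_real c" by simp
  then show ?thesis using k[OF \<theta>] by (auto simp: kbanach_of_real[OF cod.kbanach])
qed

text \<open>The choice is unique for \<theta> in \<open>R\<close>, since some \<open>T f y\<close>
  is nonzero; for other \<theta> the value is arbitrary.\<close>

definition ev :: "'y \<Rightarrow> ('x \<Rightarrow> real) \<Rightarrow> real" where
  "ev y \<theta> = (SOME c. \<forall>f\<in>A. T (\<lambda>x. \<theta> x *\<^sub>R f x) y = c *\<^sub>R T f y)"

lemma T_mult: "\<theta> \<in> R \<Longrightarrow> f \<in> A \<Longrightarrow> T (\<lambda>x. \<theta> x *\<^sub>R f x) y = ev y \<theta> *\<^sub>R T f y"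
  using someI_ex[OF T_mult_real[of \<theta> y]] unfolding ev_def by blast

lemma ev_eqI:
  assumes "\<theta> \<in> R" "\<And>f. f \<in> A \<Longrightarrow> T (\<lambda>x. \<theta> x *\<^sub>R f x) y = c *\<^sub>R T f y"
  shows "ev y \<theta> = c"
proof -
  obtain f where "f \<in> A" "T f y \<noteq> 0" using ex_nonzero by blast
  then show ?thesis using T_mult[OF assms(1), of f y] assms(2)[of f] by simp
qed

lemma ev_const: "ev y (\<lambda>_. c) = c"
  by (rule ev_eqI[OF dom.R_const]) (simp add: T_scaleR)

lemma ev_add: "\<phi> \<in> R \<Longrightarrow> \<psi> \<in> R \<Longrightarrow> ev y (\<lambda>x. \<phi> x + \<psi> x) = ev y \<phi> + ev y \<psi>"
  by (rule ev_eqI[OF dom.R_add]) (simp_all add: T_mult T_add dom.A_mult scaleR_add_left)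

lemma ev_mult: "\<phi> \<in> R \<Longrightarrow> \<psi> \<in> R \<Longrightarrow> ev y (\<lambda>x. \<phi> x * \<psi> x) = ev y \<phi> * ev y \<psi>"
  by (rule ev_eqI[OF dom.R_mult]) (simp_all add: T_mult dom.A_mult flip: scaleR_scaleR)

lemma ev_diff: "\<phi> \<in> R \<Longrightarrow> \<psi> \<in> R \<Longrightarrow> ev y (\<lambda>x. \<phi> x - \<psi> x) = ev y \<phi> - ev y \<psi>"
  using ev_add[OF dom.R_diff[of \<phi> \<psi>], of \<psi> y] by simp

lemma ev_scale: "\<phi> \<in> R \<Longrightarrow> ev y (\<lambda>x. c * \<phi> x) = c * ev y \<phi>"
  using ev_mult[OF dom.R_const[of c]] by (simp add: ev_const)

lemma abs_ev_le:
  assumes "\<phi> \<in> R" "\<And>x. \<bar>\<phi> x\<bar> \<le> b"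
  shows "\<bar>ev y \<phi>\<bar> \<le> b"
proof -
  obtain e :: 'f where "e \<noteq> 0" using one_dim_cod by (auto simp: one_dim_centralizer_def)
  define f where "f = T' (\<lambda>_. e)"
  have f: "f \<in> A" "T f y = e" by (simp_all add: f_def T'_mem T_T' cod.A_const)
  have fb: "norm (f x) \<le> norm e" for x unfolding f_def by (intro T'_bound cod.A_const) simp
  have "b \<ge> 0" using assms(2) abs_ge_zero order_trans by blast
  have "norm (T (\<lambda>x. \<phi> x *\<^sub>R f x) y) \<le> b * norm e"
    using assms fb \<open>b \<ge> 0\<close> by (intro T_bound dom.A_mult f) (auto intro!: mult_mono)
  then show ?thesis using assms f \<open>e \<noteq> 0\<close> by (simp add: T_mult)
qed

text \<open>Positivity comes from contractivity: \<open>M - \<phi>\<close> lies between 0 and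
  \<open>M\<close>, so \<open>M - ev y \<phi>\<close> cannot exceed \<open>M\<close>.\<close>

lemma ev_nonneg:
  assumes "\<phi> \<in> R" "\<And>x. \<phi> x \<ge> 0"
  shows "ev y \<phi> \<ge> 0"
proof -
  obtain M where M: "M > 0" "\<And>x. \<bar>\<phi> x\<bar> \<le> M" using dom.R_bound[OF assms(1)] by blast
  have "\<bar>ev y (\<lambda>x. M - \<phi> x)\<bar> \<le> M"
    using M(2) assms(2) by (intro abs_ev_le dom.R_diff dom.R_const assms) (simp add: abs_le_iff)
  then show ?thesis by (simp add: ev_diff dom.R_const assms ev_const)
qed

lemma ev_mono:
  assumes "\<phi> \<in> R" "\<psi> \<in> R" "\<And>x. \<phi> x \<le> \<psi> x"
  shows "ev y \<phi> \<le> ev y \<psi>"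
  using ev_nonneg[OF dom.R_diff[OF assms(2,1)], of y] assms by (simp add: ev_diff)

lemma ev_abs:
  assumes "\<phi> \<in> R"
  shows "ev y (\<lambda>x. \<bar>\<phi> x\<bar>) = \<bar>ev y \<phi>\<bar>"
proof -
  have "ev y (\<lambda>x. \<bar>\<phi> x\<bar>) * ev y (\<lambda>x. \<bar>\<phi> x\<bar>) = ev y \<phi> * ev y \<phi>"
    using ev_mult[OF dom.R_abs[OF assms] dom.R_abs[OF assms], of y] ev_mult[OF assms assms, of y] by simp
  then have "\<bar>ev y (\<lambda>x. \<bar>\<phi> x\<bar>)\<bar> = \<bar>ev y \<phi>\<bar>"
    by (metis abs_mult_self_eq real_sqrt_abs2)
  then show ?thesis using ev_nonneg[OF dom.R_abs[OF assms], of y] by simp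
qed

text \<open>Multiplying the preimage of a constant unit vector by \<phi> and applying
  \<open>T\<close> displays the transform of \<phi> as a coefficient of an element of
  \<open>B\<close>.\<close>

lemma ev_mem:
  assumes "\<phi> \<in> R"
  shows "(\<lambda>y. ev y \<phi>) \<in> Q"
proof -
  obtain e0 :: 'f where "e0 \<noteq> 0" using one_dim_cod by (auto simp: one_dim_centralizer_def)
  define e where "e = (1 / norm e0) *\<^sub>R e0"
  have e: "norm e = 1" using \<open>e0 \<noteq> 0\<close> by (simp add: e_def)
  have "T (\<lambda>x. \<phi> x *\<^sub>R T' (\<lambda>_. e) x) \<in> B"
    by (intro T_mem dom.A_mult assms T'_mem cod.A_const)
  also have "T (\<lambda>x. \<phi> x *\<^sub>R T' (\<lambda>_. e) x) = (\<lambda>y. ev y \<phi> *\<^sub>R e)"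
    by (simp add: fun_eq_iff T_mult assms T'_mem cod.A_const T_T')
  finally show ?thesis using e by (rule cod.R_coeff)
qed

text \<open>The gap \<open>M - norm (f x)\<close> is filled by a multiple of the preimage
  \<open>v\<close> of the constant unit vector in the direction of \<open>T f y\<close>. At
  \<open>y\<close> the sum has norm \<open>M - ev y (\<lambda>x. norm (f x)) + norm (T f y)\<close>,
  still at most \<open>M\<close>.\<close>

lemma norm_T_le:
  assumes f: "f \<in> A"
  shows "norm (T f y) \<le> ev y (\<lambda>x. norm (f x))"
proof (cases "T f y = 0")
  case True
  then show ?thesis using f by (simp add: ev_nonneg dom.A_norm)
next
  case False
  obtain M where M: "M > 0" "\<And>x. norm (f x) \<le> M" using dom.A_bound[OF f] by blast
  define e where "e = (1 / norm (T f y)) *\<^sub>R T f y"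
  have e: "norm e = 1" using False by (simp add: e_def)
  define v where "v = T' (\<lambda>_. e)"
  have v: "v \<in> A" "T v = (\<lambda>_. e)" by (simp_all add: v_def T'_mem T_T' cod.A_const)
  have vb: "norm (v x) \<le> 1" for x unfolding v_def by (intro T'_bound cod.A_const) (simp add: e)
  have R: "(\<lambda>x. M - norm (f x)) \<in> R" by (intro dom.R_diff dom.R_const dom.A_norm f)
  have "norm ((M - norm (f x)) *\<^sub>R v x + f x) \<le> M" for x
  proof -
    have "norm ((M - norm (f x)) *\<^sub>R v x) \<le> M - norm (f x)"
      using M(2)[of x] vb[of x] by (simp add: mult_left_le)
    then show ?thesis using norm_triangle_ineq[of "(M - norm (f x)) *\<^sub>R v x" "f x"] by simp
  qed
  from T_bound[OF dom.A_add[OF dom.A_mult[OF R v(1)] f] this, of y]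
  have "norm ((M - ev y (\<lambda>x. norm (f x))) *\<^sub>R e + T f y) \<le> M"
    by (simp add: T_add dom.A_mult R v f T_mult ev_diff dom.R_const dom.A_norm ev_const)
  moreover have "ev y (\<lambda>x. norm (f x)) \<le> M"
    using abs_ev_le[OF dom.A_norm[OF f], of M y] M(2) by simp
  ultimately show ?thesis
    using norm_add_multiple[OF False, of "M - ev y (\<lambda>x. norm (f x))"] by (simp add: e_def)
qed

end

section \<open>Point evaluations\<close>

context module_isometry
begin

text \<open>\<open>T\<close> turns multiplication by \<phi> into multiplication by its transform,
  and \<open>T'\<close> turns it back.\<close>

lemma ev_ev_inverse:
  assumes "\<phi> \<in> R"
  shows "module_isometry.ev B T' x (\<lambda>y. ev y \<phi>) = \<phi> x"
proof -
  interpret inv: module_isometry sF Q B sE R A T' T by (rule inverse)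
  show ?thesis
  proof (rule inv.ev_eqI[OF ev_mem[OF assms]])
    fix g assume g: "g \<in> B"
    have "(\<lambda>y. ev y \<phi> *\<^sub>R g y) = T (\<lambda>x. \<phi> x *\<^sub>R T' g x)"
      by (simp add: fun_eq_iff T_mult assms g T'_mem T_T')
    then show "T' (\<lambda>y. ev y \<phi> *\<^sub>R g y) x = \<phi> x *\<^sub>R T' g x"
      by (simp add: T'_T dom.A_mult assms g T'_mem)
  qed
qed

text \<open>For the reverse bound, \<open>norm_T_le\<close> for \<open>T'\<close> estimates
  \<open>norm (f x)\<close> by a transform of \<open>norm (T f y)\<close>; applying
  \<open>ev y\<close> undoes that transform.\<close>

lemma norm_T:
  assumes f: "f \<in> A"
  shows "norm (T f y) = ev y (\<lambda>x. norm (f x))"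
proof (rule antisym[OF norm_T_le[OF f]])
  interpret inv: module_isometry sF Q B sE R A T' T by (rule inverse)
  have n: "(\<lambda>y. norm (T f y)) \<in> Q" by (intro cod.A_norm T_mem f)
  have "ev y (\<lambda>x. norm (f x)) \<le> ev y (\<lambda>x. inv.ev x (\<lambda>y. norm (T f y)))"
    using inv.norm_T_le[OF T_mem[OF f]] by (intro ev_mono inv.ev_mem n dom.A_norm f) (simp add: T'_T f)
  also have "\<dots> = norm (T f y)" by (rule inv.ev_ev_inverse[OF n])
  finally show "ev y (\<lambda>x. norm (f x)) \<le> norm (T f y)" .
qed

lemma T_eq_at_point:
  assumes h: "\<And>\<phi>. \<phi> \<in> R \<Longrightarrow> ev y \<phi> = \<phi> x" and f: "f \<in> A"
  shows "T f y = T (\<lambda>_. f x) y"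
proof -
  have d: "(\<lambda>z. f z - f x) \<in> A" by (intro dom.A_diff f dom.A_const)
  have "norm (T (\<lambda>z. f z - f x) y) = 0"
    by (simp add: norm_T d h dom.A_norm)
  then show ?thesis by (simp add: T_diff f dom.A_const)
qed

text \<open>For surjectivity, the preimage of the constant \<open>v\<close> may be replaced by the
  constant it takes at \<open>x\<close>, without changing its image at \<open>y\<close>.\<close>

lemma constant_isometry:
  assumes h: "\<And>\<phi>. \<phi> \<in> R \<Longrightarrow> ev y \<phi> = \<phi> x"
  shows "(\<lambda>e. T (\<lambda>_. e) y) \<in> isoms sE sF"
proof -
  have "\<exists>e. v = T (\<lambda>_. e) y" for v
    using T_eq_at_point[OF h T'_mem[OF cod.A_const[of v]]] by (auto simp: T_T' cod.A_const)
  then have "surj (\<lambda>e. T (\<lambda>_. e) y)" by (auto simp: surj_def)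
  moreover have "norm (T (\<lambda>_. e) y) = norm e" for e
    by (simp add: norm_T dom.A_const ev_const)
  moreover have "T (\<lambda>_. e + e') y = T (\<lambda>_. e) y + T (\<lambda>_. e') y" for e e'
    using T_add[OF dom.A_const dom.A_const] by simp
  moreover have "T (\<lambda>_. sE c e) y = sF c (T (\<lambda>_. e) y)" for c e
    using T_scale[OF dom.A_const] by simp
  ultimately show ?thesis
    by (auto simp: isoms_def kbanach_linear_iff[OF dom.kbanach cod.kbanach])
qed

lemma point_map_inverse:
  assumes h: "\<And>y \<phi>. \<phi> \<in> R \<Longrightarrow> ev y \<phi> = \<phi> (h y)"
    and g: "\<And>x \<psi>. \<psi> \<in> Q \<Longrightarrow> module_isometry.ev B T' x \<psi> = \<psi> (g x)"
    and sep: "\<And>x x'. (\<And>\<phi>. \<phi> \<in> R \<Longrightarrow> \<phi> x = \<phi> x') \<Longrightarrow> x = x'"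
  shows "h (g x) = x"
proof (rule sep)
  fix \<phi> assume "\<phi> \<in> R"
  then show "\<phi> (h (g x)) = \<phi> x"
    using ev_ev_inverse[of \<phi> x] g[OF ev_mem, of \<phi> x] h[of \<phi> "g x"] by simp
qed

end

section \<open>Paths in infinite-dimensional spaces\<close>

text \<open>The coefficient of the new vector \<open>a\<close> is controlled by the positive
  distance \<open>d\<close> from \<open>a\<close> to the old span. Hence coefficients of a
  convergent sequence are Cauchy, and the scalar field is complete.\<close>

lemma closed_span_finite:
  fixes s :: "'k::{real_normed_field,banach} \<Rightarrow> 'e::banach \<Rightarrow> 'e"
  assumes s: "kbanach s" and W: "finite W"
  shows "closed (module.span s W)"
proof -
  interpret vector_space s using s by (simp add: kbanach_def)
  show ?thesis
    using W
  proof (induction W rule: finite_induct)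
    case (insert a W)
    show ?case
    proof (cases "a \<in> span W")
      case True
      then show ?thesis using insert by (simp add: span_redundant)
    next
      case False
      have ne: "span W \<noteq> {}" using span_zero by blast
      define d where "d = infdist a (span W)"
      have d: "d > 0"
        using False insert.IH in_closed_iff_infdist_zero[OF insert.IH ne, of a] infdist_nonneg[of a "span W"]
        unfolding d_def by linarith
      have low: "norm c * d \<le> norm v" if "v - s c a \<in> span W" for v c
      proof (cases "c = 0")
        case False
        have "s (- inverse c) (v - s c a) \<in> span W" by (rule span_scale[OF that])
        moreover have "s (- inverse c) (v - s c a) = a - s (inverse c) v"
          using False by (simp add: scale_right_diff_distrib)
        ultimately have "d \<le> dist a (a - s (inverse c) v)"
          unfolding d_def by (intro infdist_le) simp
        also have "\<dots> = norm v / norm c"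
          by (simp add: dist_norm kbanach_norm[OF s] norm_inverse divide_inverse)
        finally show ?thesis using False by (simp add: field_simps)
      qed simp
      show ?thesis
        unfolding closed_sequential_limits
      proof (intro allI impI, elim conjE)
        fix x z assume x: "\<forall>n. x n \<in> span (insert a W)" and z: "x \<longlonglongrightarrow> z"
        obtain c where c: "\<And>n. x n - s (c n) a \<in> span W"
          using x unfolding span_breakdown_eq by metis
        have dc: "dist (c m) (c n) \<le> dist (x m) (x n) / d" for m n
        proof -
          have "(x m - x n) - s (c m - c n) a = (x m - s (c m) a) - (x n - s (c n) a)"
            by (simp add: scale_left_diff_distrib)
          then have "(x m - x n) - s (c m - c n) a \<in> span W" using span_diff[OF c[of m] c[of n]] by metis
          from low[OF this] show ?thesis using d by (simp add: dist_norm field_simps)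
        qed
        have "Cauchy c"
        proof (rule metric_CauchyI)
          fix \<epsilon> :: real assume "\<epsilon> > 0"
          then obtain N where N: "\<And>m n. m \<ge> N \<Longrightarrow> n \<ge> N \<Longrightarrow> dist (x m) (x n) < \<epsilon> * d"
            using metric_CauchyD[OF LIMSEQ_imp_Cauchy[OF z], of "\<epsilon> * d"] d by auto
          have "dist (c m) (c n) < \<epsilon>" if "m \<ge> N" "n \<ge> N" for m n
            using dc[of m n] N[OF that] d by (simp add: less_divide_eq le_less_trans divide_less_eq)
          then show "\<exists>N. \<forall>m\<ge>N. \<forall>n\<ge>N. dist (c m) (c n) < \<epsilon>" by blast
        qed
        then obtain k where k: "c \<longlonglongrightarrow> k" using Cauchy_convergent convergent_def by blast
        have "(\<lambda>n. norm (c n - k) * norm a) \<longlonglongrightarrow> 0 * norm a"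
          using k by (intro tendsto_intros) (simp add: LIM_zero tendsto_norm_zero)
        then have "(\<lambda>n. norm (s (c n) a - s k a)) \<longlonglongrightarrow> 0"
          unfolding scale_left_diff_distrib[symmetric] kbanach_norm[OF s] by simp
        then have "(\<lambda>n. s (c n) a) \<longlonglongrightarrow> s k a"
          by (rule LIM_zero_cancel[OF tendsto_norm_zero_cancel])
        then have "(\<lambda>n. x n - s (c n) a) \<longlonglongrightarrow> z - s k a" by (rule tendsto_diff[OF z])
        then have "z - s k a \<in> span W"
          using closed_sequentially[OF insert.IH, of "\<lambda>n. x n - s (c n) a"] c by simp
        then show "z \<in> span (insert a W)" unfolding span_breakdown_eq by blast
      qed
    qed
  qed simp
qed

text \<open>Normalise \<open>x - m\<close> for \<open>x\<close> outside the closed span and an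
  almost nearest \<open>m\<close>; the tolerance \<open>2 * d\<close> produces the constant
  1/2.\<close>

lemma Riesz_lemma:
  fixes s :: "'k::{real_normed_field,banach} \<Rightarrow> 'e::banach \<Rightarrow> 'e"
  assumes s: "kbanach s" and inf: "infinite_dim s" and W: "finite W"
  shows "\<exists>v. norm v = 1 \<and> (\<forall>w\<in>module.span s W. 1/2 \<le> norm (v - w))"
proof -
  interpret vector_space s using s by (simp add: kbanach_def)
  obtain x where x: "x \<notin> span W" using inf W by (auto simp: infinite_dim_def)
  have ne: "span W \<noteq> {}" using span_zero by blast
  define d where "d = infdist x (span W)"
  have d: "d > 0"
    using x in_closed_iff_infdist_zero[OF closed_span_finite[OF s W] ne, of x] infdist_nonneg[of x "span W"]
    unfolding d_def by linarith
  have "Inf ((dist x) ` span W) < 2 * d" using d ne by (simp add: d_def infdist_def)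
  then obtain m where m: "m \<in> span W" "dist x m < 2 * d"
    using ne cInf_lessD[of "dist x ` span W" "2 * d"] by blast
  define b where "b = norm (x - m)"
  have b: "b > 0" "b < 2 * d" using x m by (auto simp: b_def dist_norm)
  define v where "v = (1/b) *\<^sub>R (x - m)"
  have scaleR: "r *\<^sub>R w \<in> span W" if "w \<in> span W" for r w
    using span_scale[OF that, of "of_real r"] kbanach_of_real[OF s] by simp
  have "1/2 \<le> norm (v - w)" if "w \<in> span W" for w
  proof -
    have "d \<le> dist x (m + b *\<^sub>R w)"
      unfolding d_def by (intro infdist_le span_add m scaleR that)
    also have "x - (m + b *\<^sub>R w) = b *\<^sub>R (v - w)"
      using b by (simp add: v_def algebra_simps)
    then have "dist x (m + b *\<^sub>R w) = b * norm (v - w)" using b by (simp add: dist_norm)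
    finally have "b * (1/2) < b * norm (v - w)" using b by linarith
    then show ?thesis using b by simp
  qed
  moreover have "norm v = 1" using b by (simp add: v_def b_def)
  ultimately show ?thesis by blast
qed

lemma ex_separated_sequence:
  fixes s :: "'k::{real_normed_field,banach} \<Rightarrow> 'e::banach \<Rightarrow> 'e"
  assumes s: "kbanach s" and inf: "infinite_dim s"
  shows "\<exists>v. \<forall>n::nat. norm (v n) = 1 \<and> (\<forall>w\<in>module.span s (v ` {..<n}). 1/2 \<le> norm (v n - w))"
proof (rule dependent_wellorder_choice)
  fix r and f g :: "nat \<Rightarrow> 'e" and x :: nat
  assume "\<And>y. y < x \<Longrightarrow> f y = g y"
  then have "f ` {..<x} = g ` {..<x}" by auto
  then show "(norm r = 1 \<and> (\<forall>w\<in>module.span s (f ` {..<x}). 1/2 \<le> norm (r - w)))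
    = (norm r = 1 \<and> (\<forall>w\<in>module.span s (g ` {..<x}). 1/2 \<le> norm (r - w)))" by simp
next
  fix x :: nat and f :: "nat \<Rightarrow> 'e"
  show "\<exists>r. norm r = 1 \<and> (\<forall>w\<in>module.span s (f ` {..<x}). 1/2 \<le> norm (r - w))"
    by (intro Riesz_lemma s inf) simp
qed

text \<open>Linear interpolation of a sequence that escapes from the span of its initial segments:
  pieces that are not adjacent stay a fixed distance apart.\<close>
lemma ex_path_without_cluster_point:
  fixes s :: "'k::{real_normed_field,banach} \<Rightarrow> 'e::banach \<Rightarrow> 'e"
  assumes s: "kbanach s" and inf: "infinite_dim s"
  shows "\<exists>\<gamma> :: real \<Rightarrow> 'e. continuous_on {0..} \<gamma> \<and> (\<forall>t\<ge>0. norm (\<gamma> t) \<le> 1) \<and>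
    (\<forall>v. \<exists>N. \<forall>t\<ge>N. 1/16 \<le> norm (\<gamma> t - v))"
proof -
  interpret vector_space s using s by (simp add: kbanach_def)
  obtain v :: "nat \<Rightarrow> 'e" where nv: "\<And>n. norm (v n) = 1"
    and sv: "\<And>n w. w \<in> span (v ` {..<n}) \<Longrightarrow> 1/2 \<le> norm (v n - w)"
    using ex_separated_sequence[OF s inf] by metis
  \<comment> \<open>Hat functions centred at the integers. At \<open>t\<close> only the indices
    \<open>\<lfloor>t\<rfloor>\<close> and its successor can contribute, whence the bound
    \<open>+ 2\<close> in the sum; further terms vanish, so near each point the number of terms can
    be fixed.\<close>
  define tent where "tent = (\<lambda>(k::nat) (t::real). max 0 (1 - \<bar>t - real k\<bar>))"
  define \<gamma> where "\<gamma> = (\<lambda>t. \<Sum>k<nat \<lfloor>t\<rfloor> + 2. tent k t *\<^sub>R v k)"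
  have sum_eq: "(\<Sum>k<m. tent k t *\<^sub>R v k) = (\<Sum>k<n. tent k t *\<^sub>R v k)"
    if "t + 1 \<le> real n" "n \<le> m" for t m n
    using that by (intro sum.mono_neutral_right) (auto simp: tent_def max_def)
  have \<gamma>_eq: "\<gamma> t = (\<Sum>k<n. tent k t *\<^sub>R v k)" if "t + 1 \<le> real n" "0 \<le> t" for t n
  proof -
    have "t + 1 \<le> real (nat \<lfloor>t\<rfloor> + 2)" using that by linarith
    then show ?thesis
      unfolding \<gamma>_def using sum_eq[of t] that by (metis nat_le_linear)
  qed
  have form: "\<gamma> (real n + r) = (1 - r) *\<^sub>R v n + r *\<^sub>R v (Suc n)" if "0 \<le> r" "r \<le> 1" for n r
  proof -
    have "\<gamma> (real n + r) = (\<Sum>k<Suc (Suc n). tent k (real n + r) *\<^sub>R v k)"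
      using that by (intro \<gamma>_eq) auto
    also have "\<dots> = (\<Sum>k\<in>{n, Suc n}. tent k (real n + r) *\<^sub>R v k)"
      using that by (intro sum.mono_neutral_right) (auto simp: tent_def max_def)
    also have "\<dots> = (1 - r) *\<^sub>R v n + r *\<^sub>R v (Suc n)"
      using that by (auto simp: tent_def max_def)
    finally show ?thesis .
  qed
  have decomp: "\<exists>n r. t = real n + r \<and> 0 \<le> r \<and> r < 1" if "t \<ge> 0" for t
    using that by (intro exI[of _ "nat \<lfloor>t\<rfloor>"] exI[of _ "frac t"]) (use frac_lt_1[of t] in \<open>auto simp: frac_def\<close>)
  have "continuous_on {0..} \<gamma>"
    unfolding continuous_on_eq_continuous_within
  proof
    fix t :: real assume t: "t \<in> {0..}"
    obtain n where n: "t + 2 \<le> real n" using real_arch_simple by blast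
    show "continuous (at t within {0..}) \<gamma>"
    proof (rule continuous_transform_within[OF _ zero_less_one t])
      show "continuous (at t within {0..}) (\<lambda>t. \<Sum>k<n. tent k t *\<^sub>R v k)"
        unfolding tent_def by (intro continuous_intros)
      show "(\<Sum>k<n. tent k t' *\<^sub>R v k) = \<gamma> t'" if "t' \<in> {0..}" "dist t' t < 1" for t'
        using that n by (intro \<gamma>_eq[symmetric]) (auto simp: dist_real_def)
    qed
  qed
  moreover have "norm (\<gamma> t) \<le> 1" if nonneg: "t \<ge> 0" for t
  proof -
    obtain n r where t: "t = real n + r" "0 \<le> r" "r < 1" using decomp[OF nonneg] by blast
    have "norm ((1 - r) *\<^sub>R v n + r *\<^sub>R v (Suc n)) \<le> (1 - r) * norm (v n) + r * norm (v (Suc n))"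
      using norm_triangle_ineq[of "(1 - r) *\<^sub>R v n" "r *\<^sub>R v (Suc n)"] t by simp
    then show ?thesis using t nv form[of r n] by simp
  qed
  moreover have "\<exists>N. \<forall>t\<ge>N. 1/16 \<le> norm (\<gamma> t - w)" for w
  proof (rule ccontr)
    assume neg: "\<not> ?thesis"
    then obtain t1 where t1: "t1 \<ge> 0" "norm (\<gamma> t1 - w) < 1/16" by (metis not_le)
    \<comment> \<open>The gap of 2 forces \<open>Suc n < m\<close>: the whole piece through
      \<open>\<gamma> t1\<close> lies in the span of the vectors before \<open>v m\<close>.\<close>
    obtain t2 where t2: "t2 \<ge> t1 + 2" "norm (\<gamma> t2 - w) < 1/16" using neg by (metis not_le)
    obtain n r where n: "t1 = real n + r" "0 \<le> r" "r < 1" using decomp[OF t1(1)] by blast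
    have "t2 \<ge> 0" using t1 t2 by simp
    then obtain m q where m: "t2 = real m + q" "0 \<le> q" "q < 1" using decomp by blast
    have "Suc n < m" using n m t2(1) by linarith
    have R: "b *\<^sub>R z \<in> span Z" if "z \<in> span Z" for b z Z
      using span_scale[OF that, of "of_real b"] kbanach_of_real[OF s] by simp
    have g1: "\<gamma> t1 \<in> span (v ` {..<m})"
    proof -
      have "v n \<in> v ` {..<m}" "v (Suc n) \<in> v ` {..<m}" using \<open>Suc n < m\<close> by auto
      then have "(1 - r) *\<^sub>R v n + r *\<^sub>R v (Suc n) \<in> span (v ` {..<m})"
        by (intro span_add R span_base)
      then show ?thesis using form[of r n] n by simp
    qed
    have scaled: "b / 2 \<le> norm (b *\<^sub>R v j - z)" if "z \<in> span (v ` {..<j})" "b \<ge> 0" for b j z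
    proof (cases "b = 0")
      case False
      have "b *\<^sub>R v j - z = b *\<^sub>R (v j - (1/b) *\<^sub>R z)" using False by (simp add: algebra_simps)
      then show ?thesis using sv[OF R[OF that(1), of "1/b"]] that(2) False by simp
    qed simp
    have g2: "\<gamma> t2 = (1 - q) *\<^sub>R v m + q *\<^sub>R v (Suc m)" using form[of q m] m by simp
    \<comment> \<open>Separating first \<open>v (Suc m)\<close>, then \<open>v m\<close>, gives the
      lower bounds \<open>q/2\<close> and \<open>(1 - q)/2 - q\<close>. Their maximum is least at
      \<open>q = 1/4\<close>, with value 1/8, twice the radius 1/16.\<close>
    have "\<gamma> t1 \<in> span (v ` {..<Suc m})"
      using g1 span_mono[of "v ` {..<m}" "v ` {..<Suc m}"] by (auto simp: lessThan_Suc)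
    then have "\<gamma> t1 - (1 - q) *\<^sub>R v m \<in> span (v ` {..<Suc m})"
      by (intro span_diff[OF _ R[OF span_base]]) auto
    from scaled[OF this m(2)] have "q / 2 \<le> norm (\<gamma> t2 - \<gamma> t1)"
      by (simp add: g2 algebra_simps)
    moreover have "(1 - q)/2 - q \<le> norm (\<gamma> t2 - \<gamma> t1)"
    proof -
      have "(1 - q)/2 \<le> norm ((1 - q) *\<^sub>R v m - \<gamma> t1)" using m by (intro scaled g1) simp
      also have "\<dots> = norm ((\<gamma> t2 - \<gamma> t1) - q *\<^sub>R v (Suc m))" by (simp add: g2 algebra_simps)
      also have "\<dots> \<le> norm (\<gamma> t2 - \<gamma> t1) + q"
        using norm_triangle_ineq4[of "\<gamma> t2 - \<gamma> t1" "q *\<^sub>R v (Suc m)"] m nv by simp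
      finally show ?thesis by linarith
    qed
    moreover have "norm (\<gamma> t2 - \<gamma> t1) < 1/8"
      using norm_triangle_ineq4[of "\<gamma> t2 - w" "\<gamma> t1 - w"] t1 t2 by simp
    ultimately show False by (simp add: field_simps)
  qed
  ultimately show ?thesis by blast
qed

section \<open>Modules of bounded continuous functions\<close>

lemma module_isometry_inv_into:
  fixes T :: "('x \<Rightarrow> 'e::banach) \<Rightarrow> ('y \<Rightarrow> 'f::banach)"
  assumes X: "function_module sE R A" and Y: "function_module sF Q B"
    and "one_dim_centralizer sE" "one_dim_centralizer sF"
    and T: "surj_lin_isom sE sF A B T"
  shows "module_isometry sE R A sF Q B T (inv_into A T)"
proof -
  interpret dom: function_module sE R A by fact
  interpret cod: function_module sF Q B by fact
  have img: "T ` A = B"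
    and add: "\<And>f g. f \<in> A \<Longrightarrow> g \<in> A \<Longrightarrow> T (\<lambda>x. f x + g x) = (\<lambda>y. T f y + T g y)"
    and scale: "\<And>f c. f \<in> A \<Longrightarrow> T (\<lambda>x. sE c (f x)) = (\<lambda>y. sF c (T f y))"
    and sup: "\<And>f. f \<in> A \<Longrightarrow> supnorm (T f) = supnorm f"
    using T unfolding surj_lin_isom_def by blast+
  have upper: "norm (f x) \<le> supnorm f" if "bounded (range f)" for f x
    unfolding supnorm_def using that by (intro cSUP_upper) (auto simp: bounded_iff bdd_above_def)
  have least: "supnorm f \<le> M" if "\<And>x. norm (f x) \<le> M" for f M
    unfolding supnorm_def using that by (intro cSUP_least) auto
  have mem: "T f \<in> B" if "f \<in> A" for f using img that by blast
  have inj: "inj_on T A"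
  proof (rule inj_onI)
    fix f g assume f: "f \<in> A" and g: "g \<in> A" and eq: "T f = T g"
    \<comment> \<open>The isometry is only assumed additive and homogeneous over the scalar field,
      so a difference is formed with the scalar -1.\<close>
    have minus: "(\<lambda>x. sE (of_real (-1)) (g x)) \<in> A" by (intro dom.A_scale g)
    have d: "(\<lambda>x. f x + sE (of_real (-1)) (g x)) \<in> A" by (intro dom.A_add f minus)
    have "T (\<lambda>x. f x + sE (of_real (-1)) (g x)) = (\<lambda>y. 0)"
      unfolding add[OF f minus] scale[OF g] kbanach_of_real[OF cod.kbanach] eq by simp
    then have "supnorm (\<lambda>x. f x + sE (of_real (-1)) (g x)) \<le> 0"
      using sup[OF d] least[of "\<lambda>y::'y. 0::'f" 0] by simp
    then have "norm (f x + sE (of_real (-1)) (g x)) \<le> 0" for x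
      using order_trans upper[OF dom.A_bounded[OF d]] by blast
    then have "norm (f x - g x) \<le> 0" for x
      unfolding kbanach_of_real[OF dom.kbanach] by simp
    then show "f = g" by (auto simp: fun_eq_iff)
  qed
  show ?thesis
  proof (intro module_isometry.intro module_isometry_axioms.intro X Y assms(3,4))
    show inv: "inv_into A T g \<in> A" "T (inv_into A T g) = g" if "g \<in> B" for g
      using that img by (auto simp: inv_into_into f_inv_into_f)
    show "norm (T f y) \<le> M" if "f \<in> A" "\<And>x. norm (f x) \<le> M" for f M y
      using upper[OF cod.A_bounded[OF mem[OF that(1)]], of y] sup[OF that(1)] least[of f M] that(2) by simp
    show "norm (inv_into A T g x) \<le> M" if "g \<in> B" "\<And>x. norm (g x) \<le> M" for g M x
      using upper[OF dom.A_bounded[OF inv(1)[OF that(1)]], of x] sup[OF inv(1)[OF that(1)]]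
        inv(2)[OF that(1)] least[of g M] that(2) by simp
  qed (use mem inj add scale in \<open>auto simp: inv_into_f_f\<close>)
qed

text \<open>Used to pass from \<open>\<phi> x *\<^sub>R e\<close> with a unit vector
  \<open>e\<close> to \<phi>.\<close>

lemma continuous_on_dist_eq:
  assumes "continuous_on S f" "\<And>x y. dist (g x) (g y) = dist (f x) (f y)"
  shows "continuous_on S g"
  using assms unfolding continuous_on by (simp add: tendsto_dist_iff[of f] tendsto_dist_iff[of g])

lemma uniformly_continuous_on_dist_eq:
  fixes f :: "'x::metric_space \<Rightarrow> 'a::metric_space" and g :: "'x \<Rightarrow> 'b::metric_space"
  assumes "uniformly_continuous_on S f" "\<And>x y. dist (g x) (g y) = dist (f x) (f y)"
  shows "uniformly_continuous_on S g"
  using assms(1) unfolding uniformly_continuous_on_def assms(2) .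

lemma kbanach_bounded_linear:
  assumes "kbanach s"
  shows "bounded_linear (s a)"
proof (rule bounded_linear_intro)
  show "s a (x + y) = s a x + s a y" for x y by (rule kbanach_add_right[OF assms])
  show "s a (r *\<^sub>R x) = r *\<^sub>R s a x" for r x
    by (rule kbanach_scaleR[OF assms])
  show "norm (s a x) \<le> norm x * norm a" for x by (simp add: kbanach_norm[OF assms])
qed

lemma CbI: "continuous_on UNIV f \<Longrightarrow> (\<And>x. norm (f x) \<le> M) \<Longrightarrow> f \<in> Cb"
  by (auto simp: Cb_def intro: boundedI)

lemma CbuI: "uniformly_continuous_on UNIV f \<Longrightarrow> (\<And>x. norm (f x) \<le> M) \<Longrightarrow> f \<in> Cbu"
  by (auto simp: Cbu_def intro: boundedI)

lemma bounded_range_scaleR: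
  fixes f :: "'x \<Rightarrow> 'e::real_normed_vector" and \<phi> :: "'x \<Rightarrow> real"
  assumes "bounded (range f)" "bounded (range \<phi>)"
  shows "bounded (range (\<lambda>x. \<phi> x *\<^sub>R f x))"
proof -
  obtain M N where "\<And>x. norm (f x) \<le> M" "M > 0" "\<And>x. \<bar>\<phi> x\<bar> \<le> N" "N > 0"
    using assms by (auto simp: bounded_pos)
  then have "norm (\<phi> x *\<^sub>R f x) \<le> N * M" for x by (auto intro!: mult_mono)
  then show ?thesis by (intro boundedI[of _ "N * M"]) auto
qed

lemma bounded_range_scale:
  assumes "kbanach s" "bounded (range f)"
  shows "bounded (range (\<lambda>x. s a (f x)))"
  using bounded_linear_image[OF assms(2) kbanach_bounded_linear[OF assms(1), of a]] by (simp add: image_image)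

lemma bounded_range_coeff:
  assumes "bounded (range (\<lambda>x. \<phi> x *\<^sub>R e))" "norm e = 1"
  shows "bounded (range \<phi>)"
  using assms by (simp add: bounded_pos)

lemma uniformly_continuous_on_scaleR_bounded:
  fixes f :: "'x::metric_space \<Rightarrow> 'e::real_normed_vector" and \<phi> :: "'x \<Rightarrow> real"
  assumes "uniformly_continuous_on UNIV f" "uniformly_continuous_on UNIV \<phi>"
    and "bounded (range f)" "bounded (range \<phi>)"
  shows "uniformly_continuous_on UNIV (\<lambda>x. \<phi> x *\<^sub>R f x)"
proof -
  obtain M N where M: "\<And>x. norm (f x) \<le> M" "M > 0" and N: "\<And>x. \<bar>\<phi> x\<bar> \<le> N" "N > 0"
    using assms(3,4) by (auto simp: bounded_pos)
  show ?thesis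
    unfolding uniformly_continuous_on_def
  proof (intro allI impI)
    fix \<epsilon> :: real assume "\<epsilon> > 0"
    then have "\<epsilon> / (2 * N) > 0" "\<epsilon> / (2 * M) > 0" using M N by auto
    then obtain d d' where d: "d > 0" "\<And>x y. dist y x < d \<Longrightarrow> dist (f y) (f x) < \<epsilon> / (2 * N)"
      and d': "d' > 0" "\<And>x y. dist y x < d' \<Longrightarrow> dist (\<phi> y) (\<phi> x) < \<epsilon> / (2 * M)"
      using assms(1,2) unfolding uniformly_continuous_on_def by (metis UNIV_I)
    have "dist (\<phi> y *\<^sub>R f y) (\<phi> x *\<^sub>R f x) < \<epsilon>" if "dist y x < min d d'" for x y
    proof -
      have "\<phi> y *\<^sub>R f y - \<phi> x *\<^sub>R f x = \<phi> y *\<^sub>R (f y - f x) + (\<phi> y - \<phi> x) *\<^sub>R f x"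
        by (simp add: algebra_simps)
      then have "dist (\<phi> y *\<^sub>R f y) (\<phi> x *\<^sub>R f x) \<le> \<bar>\<phi> y\<bar> * dist (f y) (f x) + dist (\<phi> y) (\<phi> x) * norm (f x)"
        unfolding dist_norm using norm_triangle_ineq[of "\<phi> y *\<^sub>R (f y - f x)" "(\<phi> y - \<phi> x) *\<^sub>R f x"] by simp
      also have "\<dots> \<le> N * dist (f y) (f x) + dist (\<phi> y) (\<phi> x) * M"
        using M N by (intro add_mono mult_right_mono mult_left_mono) auto
      also have "\<dots> < N * (\<epsilon> / (2 * N)) + (\<epsilon> / (2 * M)) * M"
        using that d(2)[of y x] d'(2)[of y x] M N by (intro add_strict_mono mult_strict_left_mono mult_strict_right_mono) auto
      also have "\<dots> = \<epsilon>" using M N by simp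
      finally show ?thesis .
    qed
    then show "\<exists>d>0. \<forall>x\<in>UNIV. \<forall>x'\<in>UNIV. dist x' x < d \<longrightarrow> dist (\<phi> x' *\<^sub>R f x') (\<phi> x *\<^sub>R f x) < \<epsilon>"
      using d d' by (intro exI[of _ "min d d'"]) auto
  qed
qed

lemma Cb_module:
  fixes s :: "'k::{real_normed_field,banach} \<Rightarrow> 'e::banach \<Rightarrow> 'e"
  assumes "kbanach s"
  shows "function_module s (Cb :: ('x::topological_space \<Rightarrow> real) set) Cb"
proof unfold_locales
  fix \<phi> \<psi> :: "'x \<Rightarrow> real" and f g :: "'x \<Rightarrow> 'e" and a e
  show "(\<lambda>x. \<phi> x + \<psi> x) \<in> Cb" if "\<phi> \<in> Cb" "\<psi> \<in> Cb"
    using that by (auto simp: Cb_def intro!: continuous_intros bounded_plus_comp)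
  show "(\<lambda>x. \<phi> x * \<psi> x) \<in> Cb" if "\<phi> \<in> Cb" "\<psi> \<in> Cb"
    using that bounded_range_scaleR[of \<psi> \<phi>] by (auto simp: Cb_def intro!: continuous_intros)
  show "(\<lambda>x. f x + g x) \<in> Cb" if "f \<in> Cb" "g \<in> Cb"
    using that by (auto simp: Cb_def intro!: continuous_intros bounded_plus_comp)
  show "(\<lambda>x. s a (f x)) \<in> Cb" if "f \<in> Cb"
    using that bounded_linear.continuous_on[OF kbanach_bounded_linear[OF assms], of UNIV f a]
      bounded_range_scale[OF assms] by (auto simp: Cb_def)
  show "(\<lambda>x. \<phi> x *\<^sub>R f x) \<in> Cb" if "\<phi> \<in> Cb" "f \<in> Cb"
    using that by (auto simp: Cb_def intro!: continuous_intros bounded_range_scaleR)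
  show "(\<lambda>x. norm (f x)) \<in> Cb" if "f \<in> Cb"
    using that by (auto simp: Cb_def bounded_norm_comp intro!: continuous_intros)
  show "(\<lambda>x. \<bar>\<phi> x\<bar>) \<in> Cb" if "\<phi> \<in> Cb"
    using that bounded_norm_comp[of \<phi> UNIV] by (auto simp: Cb_def intro!: continuous_intros)
  show "\<phi> \<in> Cb" if "(\<lambda>x. \<phi> x *\<^sub>R e) \<in> Cb" "norm e = 1"
    using that bounded_range_coeff[of \<phi> e]
    by (auto simp: Cb_def dist_norm simp flip: scaleR_diff_left
        intro: continuous_on_dist_eq[of UNIV "\<lambda>x. \<phi> x *\<^sub>R e"])
qed (use assms in \<open>auto simp: Cb_def\<close>)

lemma Cbu_module:
  fixes s :: "'k::{real_normed_field,banach} \<Rightarrow> 'e::banach \<Rightarrow> 'e"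
  assumes "kbanach s"
  shows "function_module s (Cbu :: ('x::metric_space \<Rightarrow> real) set) Cbu"
proof unfold_locales
  fix \<phi> \<psi> :: "'x \<Rightarrow> real" and f g :: "'x \<Rightarrow> 'e" and a e
  show "(\<lambda>x. \<phi> x + \<psi> x) \<in> Cbu" if "\<phi> \<in> Cbu" "\<psi> \<in> Cbu"
    using that by (auto simp: Cbu_def intro!: uniformly_continuous_on_add bounded_plus_comp)
  show "(\<lambda>x. \<phi> x * \<psi> x) \<in> Cbu" if "\<phi> \<in> Cbu" "\<psi> \<in> Cbu"
    using that bounded_range_scaleR[of \<psi> \<phi>] uniformly_continuous_on_scaleR_bounded[of \<psi> \<phi>]
    by (auto simp: Cbu_def)
  show "(\<lambda>x. f x + g x) \<in> Cbu" if "f \<in> Cbu" "g \<in> Cbu"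
    using that by (auto simp: Cbu_def intro!: uniformly_continuous_on_add bounded_plus_comp)
  show "(\<lambda>x. s a (f x)) \<in> Cbu" if "f \<in> Cbu"
    using that bounded_linear.uniformly_continuous_on[OF kbanach_bounded_linear[OF assms], of UNIV f a]
      bounded_range_scale[OF assms] by (auto simp: Cbu_def)
  show "(\<lambda>x. \<phi> x *\<^sub>R f x) \<in> Cbu" if "\<phi> \<in> Cbu" "f \<in> Cbu"
    using that by (auto simp: Cbu_def intro!: uniformly_continuous_on_scaleR_bounded bounded_range_scaleR)
  show "(\<lambda>x. norm (f x)) \<in> Cbu" if "f \<in> Cbu"
    using that by (auto simp: Cbu_def bounded_norm_comp intro!: uniformly_continuous_on_norm)
  show "(\<lambda>x. \<bar>\<phi> x\<bar>) \<in> Cbu" if "\<phi> \<in> Cbu"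
    using that bounded_norm_comp[of \<phi> UNIV] uniformly_continuous_on_norm[of UNIV \<phi>] by (auto simp: Cbu_def)
  show "\<phi> \<in> Cbu" if "(\<lambda>x. \<phi> x *\<^sub>R e) \<in> Cbu" "norm e = 1"
    using that bounded_range_coeff[of \<phi> e]
    by (auto simp: Cbu_def dist_norm simp flip: scaleR_diff_left
        intro: uniformly_continuous_on_dist_eq[of UNIV "\<lambda>x. \<phi> x *\<^sub>R e"])
qed (use assms in \<open>auto simp: Cbu_def uniformly_continuous_on_const\<close>)

section \<open>Realcompact spaces\<close>

text \<open>A basic open set restricts finitely many coordinates. Exact agreement on these is enough
  here, because common zeros of kernel functions provide it.\<close>

lemma product_topology_euclidean_box:
  assumes "openin (product_topology (\<lambda>_. euclideanreal) I) W" "p \<in> W"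
  shows "\<exists>J. finite J \<and> J \<subseteq> I \<and> (\<forall>q\<in>extensional I. (\<forall>i\<in>J. q i = p i) \<longrightarrow> q \<in> W)"
proof -
  obtain U where U: "finite {i \<in> I. U i \<noteq> UNIV}" "p \<in> Pi\<^sub>E I U" "Pi\<^sub>E I U \<subseteq> W"
    using assms unfolding openin_product_topology_alt by force
  have "q \<in> W" if q: "q \<in> extensional I" "\<forall>i\<in>{i \<in> I. U i \<noteq> UNIV}. q i = p i" for q
  proof -
    have "q i \<in> U i" if "i \<in> I" for i
      using q(2) U(2) that by (cases "U i = UNIV") (auto simp: PiE_mem)
    then have "q \<in> Pi\<^sub>E I U" using q(1) by (simp add: PiE_iff)
    then show ?thesis using U(3) by blast
  qed
  then show ?thesis using U(1) by blast
qed

text \<open>\<open>k\<close> is the homeomorphism onto the closed set and \<open>l\<close> its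
  inverse. Points of the product are extensional functions, with a default value outside
  \<open>I\<close>.\<close>

definition closed_line_embedding ::
  "('a \<Rightarrow> real) set \<Rightarrow> (('a \<Rightarrow> real) \<Rightarrow> real) set \<Rightarrow>
    ('a::topological_space \<Rightarrow> (('a \<Rightarrow> real) \<Rightarrow> real)) \<Rightarrow> ((('a \<Rightarrow> real) \<Rightarrow> real) \<Rightarrow> 'a) \<Rightarrow> bool" where
  "closed_line_embedding I S k l \<longleftrightarrow>
    closedin (product_topology (\<lambda>_. euclideanreal) I) S \<and>
    continuous_map (subtopology (product_topology (\<lambda>_. euclideanreal) I) S) euclidean l \<and>
    (\<forall>x. k x \<in> S \<and> l (k x) = x \<and> k x \<in> extensional I) \<and> (\<forall>p\<in>S. k (l p) = p) \<and>
    (\<forall>i\<in>I. continuous_on UNIV (\<lambda>x. k x i))"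

lemma realcompact_closed_line_embedding:
  assumes "realcompact (euclidean :: 'a::topological_space topology)"
  shows "\<exists>I S (k :: 'a \<Rightarrow> _) l. closed_line_embedding I S k l"
proof -
  obtain I :: "('a \<Rightarrow> real) set" and S
    where S: "closedin (product_topology (\<lambda>_. euclideanreal) I) S"
      and "(euclidean :: 'a topology) homeomorphic_space subtopology (product_topology (\<lambda>_. euclideanreal) I) S"
    using assms unfolding realcompact_def by blast
  then obtain k l where kl: "homeomorphic_maps (euclidean :: 'a topology)
      (subtopology (product_topology (\<lambda>_. euclideanreal) I) S) k l"
    unfolding homeomorphic_space_def by blast
  have "S \<subseteq> topspace (product_topology (\<lambda>_. euclideanreal) I)"
    using S by (rule closedin_subset)
  then have top: "topspace (subtopology (product_topology (\<lambda>_. euclideanreal) I) S) = S"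
    by (simp only: topspace_subtopology_subset)
  have hom: "continuous_map euclidean (subtopology (product_topology (\<lambda>_. euclideanreal) I) S) k"
    "continuous_map (subtopology (product_topology (\<lambda>_. euclideanreal) I) S) euclidean l"
    "\<forall>x. l (k x) = x" "\<forall>p\<in>S. k (l p) = p"
    using kl unfolding homeomorphic_maps_def top by simp_all
  have "continuous_map euclidean (product_topology (\<lambda>_. euclideanreal) I) k" and kS: "\<forall>x. k x \<in> S"
    using hom(1) unfolding continuous_map_in_subtopology by auto
  then have "\<forall>x. k x \<in> extensional I" "\<forall>i\<in>I. continuous_on UNIV (\<lambda>x. k x i)"
    unfolding continuous_map_componentwise by auto
  with S hom(2-) kS have "closed_line_embedding I S k l"
    unfolding closed_line_embedding_def by simp
  then show ?thesis by blast
qed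

lemma realcompact_separates:
  assumes rc: "realcompact (euclidean :: 'a::topological_space topology)"
    and eq: "\<And>\<phi>. \<phi> \<in> (Cb :: ('a \<Rightarrow> real) set) \<Longrightarrow> \<phi> x = \<phi> x'"
  shows "x = x'"
proof -
  obtain I S k l where "closed_line_embedding I S (k :: 'a \<Rightarrow> _) l"
    using realcompact_closed_line_embedding[OF rc] by blast
  then have k: "\<And>x. l (k x) = x" "\<And>x. k x \<in> extensional I" "\<And>i. i \<in> I \<Longrightarrow> continuous_on UNIV (\<lambda>x. k x i)"
    by (simp_all add: closed_line_embedding_def)
  have "k x i = k x' i" if "i \<in> I" for i
  proof -
    \<comment> \<open>The coordinates may be unbounded; \<open>arctan\<close> bounds them and stays
      injective.\<close>
    have "(\<lambda>x. arctan (k x i)) \<in> Cb"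
    proof (rule CbI)
      show "continuous_on UNIV (\<lambda>x. arctan (k x i))" by (intro continuous_intros k that)
      show "norm (arctan (k x i)) \<le> pi/2" for x
        using arctan_lbound[of "k x i"] arctan_ubound[of "k x i"] by (simp add: abs_le_iff)
    qed
    from eq[OF this] show ?thesis by (simp add: arctan_eq_iff)
  qed
  then have "k x = k x'" using k(2) by (metis extensionalityI)
  then show ?thesis using k(1) by metis
qed

text \<open>The zero sets of the functions in the kernel of \<open>\<xi>\<close> have the finite intersection property,
  because a sum of absolute values lies in the kernel again. Dividing out a positive function
  extends \<open>\<xi>\<close> to the (unbounded) coordinates of the closed embedding into a product of lines.\<close>
lemma realcompact_character:
  fixes \<xi> :: "('a::topological_space \<Rightarrow> real) \<Rightarrow> real"
  assumes rc: "realcompact (euclidean :: 'a topology)"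
    and const: "\<And>c. \<xi> (\<lambda>_. c) = c"
    and add: "\<And>\<phi> \<psi>. \<phi> \<in> Cb \<Longrightarrow> \<psi> \<in> Cb \<Longrightarrow> \<xi> (\<lambda>x. \<phi> x + \<psi> x) = \<xi> \<phi> + \<xi> \<psi>"
    and scale: "\<And>\<phi> c. \<phi> \<in> Cb \<Longrightarrow> \<xi> (\<lambda>x. c * \<phi> x) = c * \<xi> \<phi>"
    and abs: "\<And>\<phi>. \<phi> \<in> Cb \<Longrightarrow> \<xi> (\<lambda>x. \<bar>\<phi> x\<bar>) = \<bar>\<xi> \<phi>\<bar>"
    and pos: "\<And>\<phi>. \<phi> \<in> Cb \<Longrightarrow> (\<And>x. \<phi> x > 0) \<Longrightarrow> \<xi> \<phi> \<noteq> 0"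
  shows "\<exists>x. \<forall>\<phi>\<in>Cb. \<xi> \<phi> = \<phi> x"
proof -
  have "kbanach ((*) :: real \<Rightarrow> real \<Rightarrow> real)"
    by (simp add: kbanach_def vector_space_over_itself.vector_space_axioms abs_mult)
  then interpret Cb: function_module "(*) :: real \<Rightarrow> real \<Rightarrow> real" "Cb :: ('a \<Rightarrow> real) set" Cb
    by (rule Cb_module)
  obtain I S k l where emb: "closed_line_embedding I S (k :: 'a \<Rightarrow> _) l"
    using realcompact_closed_line_embedding[OF rc] by blast
  have S: "closedin (product_topology (\<lambda>_. euclideanreal) I) S"
    and l: "continuous_map (subtopology (product_topology (\<lambda>_. euclideanreal) I) S) euclidean l"
    and k: "\<And>x. k x \<in> S" "\<And>x. l (k x) = x" "\<And>p. p \<in> S \<Longrightarrow> k (l p) = p"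
        "\<And>x. k x \<in> extensional I" "\<And>i. i \<in> I \<Longrightarrow> continuous_on UNIV (\<lambda>x. k x i)"
    using emb by (simp_all add: closed_line_embedding_def)
  \<comment> \<open>Without a common zero the sum of absolute values would be strictly positive yet
    killed by \<xi>, contrary to \<open>pos\<close>.\<close>
  have zeros: "\<exists>x. \<forall>\<phi>\<in>F. \<phi> x = 0" if "finite F" "F \<subseteq> Cb" "\<forall>\<phi>\<in>F. \<xi> \<phi> = 0" for F
  proof -
    have "(\<lambda>x. \<Sum>\<phi>\<in>F. \<bar>\<phi> x\<bar>) \<in> Cb \<and> \<xi> (\<lambda>x. \<Sum>\<phi>\<in>F. \<bar>\<phi> x\<bar>) = 0"
      using that
    proof (induction F rule: finite_induct)
      case (insert \<psi> F)
      then have IH: "(\<lambda>x. \<Sum>\<phi>\<in>F. \<bar>\<phi> x\<bar>) \<in> Cb" "\<xi> (\<lambda>x. \<Sum>\<phi>\<in>F. \<bar>\<phi> x\<bar>) = 0" by auto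
      have \<psi>: "\<psi> \<in> Cb" "\<xi> \<psi> = 0" using insert.prems by auto
      show ?case
        unfolding sum.insert[OF insert.hyps]
        using Cb.R_add[OF Cb.R_abs[OF \<psi>(1)] IH(1)]
        by (simp only: add[OF Cb.R_abs[OF \<psi>(1)] IH(1)] abs[OF \<psi>(1)] \<psi>(2) IH(2)) simp
    qed (simp add: const Cb.R_const)
    then obtain x where "\<not> (\<Sum>\<phi>\<in>F. \<bar>\<phi> x\<bar>) > 0" using pos by blast
    moreover have "(\<Sum>\<phi>\<in>F. \<bar>\<phi> x\<bar>) \<ge> 0" by (simp add: sum_nonneg)
    ultimately have "(\<Sum>\<phi>\<in>F. \<bar>\<phi> x\<bar>) = 0" by linarith
    then show ?thesis using that(1) by (auto simp: sum_nonneg_eq_0_iff)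
  qed
  \<comment> \<open>The positive weight \<open>u i\<close> makes coordinate \<open>i\<close>
    bounded. The quotient \<open>r i\<close> is the value of \<xi> on that coordinate, and
    \<open>v i\<close> is a kernel function vanishing only where the coordinate equals
    \<open>r i\<close>.\<close>
  define u where "u = (\<lambda>i x. 1 / (1 + \<bar>k x i\<bar>))"
  define r where "r = (\<lambda>i. \<xi> (\<lambda>x. k x i * u i x) / \<xi> (u i))"
  define v where "v = (\<lambda>i x. k x i * u i x + (- r i) * u i x)"
  have u: "u i \<in> Cb" "\<xi> (u i) \<noteq> 0" if "i \<in> I" for i
  proof -
    show "u i \<in> Cb"
    proof (rule CbI)
      show "continuous_on UNIV (u i)" unfolding u_def by (intro continuous_intros k that) (auto simp: add_nonneg_eq_0_iff)
      show "norm (u i x) \<le> 1" for x by (simp add: u_def field_simps)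
    qed
    then show "\<xi> (u i) \<noteq> 0" by (rule pos) (auto simp: u_def intro: add_pos_nonneg)
  qed
  have ku: "(\<lambda>x. k x i * u i x) \<in> Cb" if "i \<in> I" for i
  proof (rule CbI)
    show "continuous_on UNIV (\<lambda>x. k x i * u i x)"
      unfolding u_def by (intro continuous_intros k that) (auto simp: add_nonneg_eq_0_iff)
    show "norm (k x i * u i x) \<le> 1" for x by (simp add: u_def field_simps abs_mult)
  qed
  have v: "v i \<in> Cb" "\<xi> (v i) = 0" if "i \<in> I" for i
  proof -
    have "(\<lambda>x. (- r i) * u i x) \<in> Cb" by (rule Cb.R_scale[OF u(1)[OF that]])
    then show "v i \<in> Cb" "\<xi> (v i) = 0"
      unfolding v_def using ku[OF that] u[OF that] by (auto simp only: add scale Cb.R_add) (simp add: r_def)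
  qed
  have v0: "k x i = r i" if "v i x = 0" for x i
  proof -
    have "(k x i - r i) * u i x = 0" using that by (simp add: v_def algebra_simps)
    moreover have "u i x \<noteq> 0" by (simp add: u_def add_nonneg_eq_0_iff)
    ultimately show ?thesis by simp
  qed
  have agree: "\<exists>x. \<phi> x = \<xi> \<phi> \<and> (\<forall>i\<in>J. k x i = r i)" if J: "finite J" "J \<subseteq> I" and \<phi>: "\<phi> \<in> Cb" for J \<phi>
  proof -
    have d: "(\<lambda>x. \<phi> x + (- \<xi> \<phi>)) \<in> Cb" "\<xi> (\<lambda>x. \<phi> x + (- \<xi> \<phi>)) = 0"
      using Cb.R_add[OF \<phi> Cb.R_const[of "- \<xi> \<phi>"]] add[OF \<phi> Cb.R_const[of "- \<xi> \<phi>"]]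
      by (simp_all add: const)
    obtain x where "\<forall>\<psi>\<in>insert (\<lambda>x. \<phi> x + (- \<xi> \<phi>)) (v ` J). \<psi> x = 0"
      using zeros[of "insert (\<lambda>x. \<phi> x + (- \<xi> \<phi>)) (v ` J)"] J v d by auto
    then show ?thesis using v0 by (intro exI[of _ x]) auto
  qed
  define p where "p = restrict r I"
  have "p \<in> S"
  proof (rule ccontr)
    assume "p \<notin> S"
    have "openin (product_topology (\<lambda>_. euclideanreal) I) (topspace (product_topology (\<lambda>_. euclideanreal) I) - S)"
      using S by (simp add: closedin_def)
    moreover have "p \<in> topspace (product_topology (\<lambda>_. euclideanreal) I) - S"
      using \<open>p \<notin> S\<close> by (simp add: p_def)
    ultimately obtain J where J: "finite J" "J \<subseteq> I"
      "\<And>q. q \<in> extensional I \<Longrightarrow> (\<forall>i\<in>J. q i = p i) \<Longrightarrow> q \<notin> S"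
      using product_topology_euclidean_box by (metis DiffE)
    obtain x where "\<forall>i\<in>J. k x i = r i" using agree[OF J(1,2) Cb.R_const] by blast
    then have "k x \<notin> S" using J(2) k(4) by (intro J(3)) (auto simp: p_def)
    then show False using k(1) by blast
  qed
  have "\<xi> \<phi> = \<phi> (l p)" if \<phi>: "\<phi> \<in> Cb" for \<phi>
  proof (rule ccontr)
    assume neq: "\<xi> \<phi> \<noteq> \<phi> (l p)"
    let ?P = "product_topology (\<lambda>_. euclideanreal) I"
    have "continuous_map (subtopology ?P S) euclideanreal (\<phi> \<circ> l)"
      using l \<phi> by (intro continuous_map_compose[of _ euclidean]) (auto simp: Cb_def)
    then have "openin (subtopology ?P S) {q \<in> topspace (subtopology ?P S). (\<phi> \<circ> l) q \<in> - {\<xi> \<phi>}}"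
      by (rule openin_continuous_map_preimage) (simp add: open_Compl)
    then obtain W where W: "openin ?P W" "{q \<in> topspace (subtopology ?P S). (\<phi> \<circ> l) q \<in> - {\<xi> \<phi>}} = W \<inter> S"
      by (auto simp: openin_subtopology)
    have top: "topspace (subtopology ?P S) = S"
      using closedin_subset[OF S] by (simp only: topspace_subtopology_subset)
    have "p \<in> W \<inter> S" unfolding W(2)[symmetric] top using neq \<open>p \<in> S\<close> by simp
    then have "p \<in> W" by simp
    then obtain J where J: "finite J" "J \<subseteq> I"
      "\<And>q. q \<in> extensional I \<Longrightarrow> (\<forall>i\<in>J. q i = p i) \<Longrightarrow> q \<in> W"
      using product_topology_euclidean_box[OF W(1)] by metis
    obtain x where x: "\<phi> x = \<xi> \<phi>" "\<forall>i\<in>J. k x i = r i" using agree[OF J(1,2) \<phi>] by blast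
    then have "k x \<in> W" using J(2) k(4) by (intro J(3)) (auto simp: p_def)
    then have "k x \<in> W \<inter> S" using k(1) by simp
    then have "k x \<in> {q \<in> S. (\<phi> \<circ> l) q \<in> - {\<xi> \<phi>}}" unfolding W(2)[symmetric] top .
    then show False using x(1) k(2) by simp
  qed
  then show ?thesis by blast
qed

text \<open>Complete regularity gives each neighbourhood of \<open>h y\<close> a function that is 0
  at \<open>h y\<close> and 1 outside it.\<close>

lemma completely_regular_continuous:
  fixes h :: "'y::topological_space \<Rightarrow> 'x::topological_space"
  assumes cr: "completely_regular_space (euclidean :: 'x topology)"
    and cont: "\<And>\<phi>. \<phi> \<in> (Cb :: ('x \<Rightarrow> real) set) \<Longrightarrow> continuous_on UNIV (\<lambda>y. \<phi> (h y))"
  shows "continuous_on UNIV h"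
proof -
  have "\<exists>V. open V \<and> y \<in> V \<and> V \<subseteq> h -` U" if U: "open U" "h y \<in> U" for U y
  proof -
    have "closedin euclidean (- U) \<and> h y \<in> topspace euclidean - (- U)" using U by auto
    then obtain \<phi> :: "'x \<Rightarrow> real" where \<phi>: "continuous_map euclidean (top_of_set {0..1}) \<phi>" "\<phi> (h y) = 0" "\<phi> ` (- U) \<subseteq> {1}"
      using cr unfolding completely_regular_space_def by blast
    have "\<phi> \<in> Cb"
    proof (rule CbI)
      show "continuous_on UNIV \<phi>" using \<phi>(1) by (simp add: continuous_map_in_subtopology)
      show "norm (\<phi> x) \<le> 1" for x using \<phi>(1) by (auto simp: continuous_map_in_subtopology Pi_iff)
    qed
    then have "open {y. \<phi> (h y) < 1}"
      by (intro open_Collect_less cont continuous_on_const)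
    moreover have "{y. \<phi> (h y) < 1} \<subseteq> h -` U" using \<phi>(3) by fastforce
    ultimately show ?thesis using \<phi>(2) by (intro exI[of _ "{y. \<phi> (h y) < 1}"]) auto
  qed
  then show ?thesis
    unfolding continuous_on_open_vimage[OF open_UNIV] by (subst open_subopen) auto
qed

text \<open>If \<open>u\<close> vanishes at the ideal point attached to \<open>y\<close>, then near that point
  every \<open>f\<close> is norm-close to \<open>T'\<close> of a constant function; moving along a path without cluster
  point as \<open>u \<rightarrow> 0\<close> produces an \<open>f\<close> for which this fails.\<close>
lemma Cb_ev_nonzero:
  fixes T :: "('x::topological_space \<Rightarrow> 'e::banach) \<Rightarrow> ('y::topological_space \<Rightarrow> 'f::banach)"
  assumes iso: "module_isometry sE Cb Cb sF Cb Cb T T'" and inf: "infinite_dim sF"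
    and u: "u \<in> Cb" "\<And>x. u x > 0"
  shows "module_isometry.ev Cb T y u \<noteq> 0"
proof
  interpret module_isometry sE Cb Cb sF Cb Cb T T' by (rule iso)
  interpret inv: module_isometry sF Cb Cb sE Cb Cb T' T by (rule inverse)
  assume zero: "ev y u = 0"
  obtain \<gamma> :: "real \<Rightarrow> 'f" where \<gamma>: "continuous_on {0..} \<gamma>" "\<And>t. t \<ge> 0 \<Longrightarrow> norm (\<gamma> t) \<le> 1"
    "\<And>v. \<exists>N. \<forall>t\<ge>N. 1/16 \<le> norm (\<gamma> t - v)"
    using ex_path_without_cluster_point[OF cod.kbanach inf] by blast
  \<comment> \<open>Each \<open>U x\<close> preserves norms by \<open>norm_T\<close> for the
    inverse; surjectivity of \<open>U x\<close> is not claimed.\<close>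
  define U where "U = (\<lambda>x v. T' (\<lambda>_. v) x)"
  have U_norm: "norm (U x v) = norm v" for x v
    by (simp add: U_def inv.norm_T cod.A_const inv.ev_const)
  have U_diff: "U x (v - w) = U x v - U x w" for x v w
    unfolding U_def by (simp add: T'_diff cod.A_const)
  have u_cont: "continuous_on UNIV u" using u by (simp add: Cb_def)
  \<comment> \<open>The path parameter runs to infinity as \<open>u\<close> tends to 0.\<close>
  define t where "t = (\<lambda>x. 1 / u x)"
  have t: "t x \<ge> 0" for x using u(2)[of x] by (simp add: t_def)
  have t_cont: "continuous_on UNIV t"
    unfolding t_def using u(2) by (intro continuous_intros u_cont) (metis less_irrefl)
  have \<gamma>t: "continuous_on UNIV (\<lambda>x. \<gamma> (t x))"
    by (rule continuous_on_compose2[OF \<gamma>(1) t_cont]) (use t in auto)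
  define f where "f = (\<lambda>x. U x (\<gamma> (t x)))"
  have f: "f \<in> Cb"
  proof (rule CbI)
    show "norm (f x) \<le> 1" for x using \<gamma>(2) t by (simp add: f_def U_norm)
    show "continuous_on UNIV f"
      unfolding continuous_on
    \<comment> \<open>Both the operator and its argument vary with \<open>z\<close>. The argument is
      frozen at \<open>\<gamma> (t x)\<close> first; the remainder is controlled because
      \<open>U z\<close> is isometric.\<close>
    proof
      fix x :: 'x
      have "continuous_on UNIV (\<lambda>z. U z (\<gamma> (t x)))"
        using T'_mem[OF cod.A_const[of "\<gamma> (t x)"]] by (simp add: U_def Cb_def)
      then have "((\<lambda>z. U z (\<gamma> (t x))) \<longlongrightarrow> f x) (at x)"
        by (auto simp: continuous_on f_def)
      moreover have "((\<lambda>z. U z (\<gamma> (t z) - \<gamma> (t x))) \<longlongrightarrow> 0) (at x)"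
      proof (rule tendsto_norm_zero_cancel)
        have "((\<lambda>z. \<gamma> (t z) - \<gamma> (t x)) \<longlongrightarrow> 0) (at x)"
          using \<gamma>t by (intro LIM_zero) (auto simp: continuous_on)
        then show "((\<lambda>z. norm (U z (\<gamma> (t z) - \<gamma> (t x)))) \<longlongrightarrow> 0) (at x)"
          unfolding U_norm by (rule tendsto_norm_zero)
      qed
      ultimately have "((\<lambda>z. U z (\<gamma> (t x)) + U z (\<gamma> (t z) - \<gamma> (t x))) \<longlongrightarrow> f x + 0) (at x)"
        by (rule tendsto_add)
      then show "(f \<longlongrightarrow> f x) (at x)"
        by (simp add: U_diff f_def)
    qed
  qed
  define v where "v = T f y"
  have c: "T' (\<lambda>_. v) \<in> Cb" by (intro T'_mem cod.A_const)
  have d: "(\<lambda>x. f x - T' (\<lambda>_. v) x) \<in> Cb" by (intro dom.A_diff f c)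
  have "f x - T' (\<lambda>_. v) x = U x (\<gamma> (t x) - v)" for x by (simp add: U_diff) (simp add: U_def f_def)
  then have nd: "norm (f x - T' (\<lambda>_. v) x) = norm (\<gamma> (t x) - v)" for x by (simp add: U_norm)
  have "norm (T (\<lambda>x. f x - T' (\<lambda>_. v) x) y) = 0"
    by (simp add: T_diff f c T_T' cod.A_const) (simp add: v_def)
  then have ev0: "ev y (\<lambda>x. norm (\<gamma> (t x) - v)) = 0"
    unfolding norm_T[OF d] nd by simp
  have mem: "(\<lambda>x. norm (\<gamma> (t x) - v)) \<in> Cb" using dom.A_norm[OF d] by (simp add: nd)
  obtain N0 where N0: "\<And>t. t \<ge> N0 \<Longrightarrow> 1/16 \<le> norm (\<gamma> t - v)" using \<gamma>(3) by blast
  define N where "N = max 1 N0"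
  \<comment> \<open>For \<open>t x \<ge> N\<close> the path is at least 1/16 away from
    \<open>v\<close>, otherwise \<open>u x\<close> is at least \<open>1/N\<close>. So
    \<open>ev y\<close> would kill two functions whose sum is bounded below.\<close>
  define m where "m = min (1/16) (1/N)"
  have m: "m > 0" by (simp add: m_def N_def)
  have "m \<le> norm (\<gamma> (t x) - v) + u x" for x
  proof (cases "t x \<ge> N")
    case True
    then show ?thesis using N0[of "t x"] u(2)[of x] by (simp add: N_def m_def)
  next
    case False
    moreover have "N > 0" by (simp add: N_def)
    ultimately have "1 / N \<le> u x" using u(2)[of x] by (simp add: t_def field_simps)
    then show ?thesis using norm_ge_zero[of "\<gamma> (t x) - v"] unfolding m_def by linarith
  qed
  then have "ev y (\<lambda>_. m) \<le> ev y (\<lambda>x. norm (\<gamma> (t x) - v) + u x)"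
    by (intro ev_mono dom.R_const dom.R_add mem u)
  then show False using m by (simp add: ev_const ev_add mem u ev0 zero)
qed

lemma homeomorphism_UNIV_I:
  assumes "\<And>x. h (g x) = x" "\<And>y. g (h y) = y" "continuous_on UNIV h" "continuous_on UNIV g"
  shows "homeomorphism UNIV UNIV h g"
  using assms by (auto simp: homeomorphism_def) (metis rangeI)+

theorem Cb_strong_BS:
  fixes T :: "('x::topological_space \<Rightarrow> 'e::banach) \<Rightarrow> ('y::topological_space \<Rightarrow> 'f::banach)"
  assumes "kbanach sE" "kbanach sF" "one_dim_centralizer sE" "one_dim_centralizer sF"
    and X: "completely_regular_space (euclidean :: 'x topology)" "realcompact (euclidean :: 'x topology)"
    and Y: "completely_regular_space (euclidean :: 'y topology)" "realcompact (euclidean :: 'y topology)"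
    and inf: "infinite_dim sE" "infinite_dim sF" and T: "surj_lin_isom sE sF Cb Cb T"
  shows "strong_BS sE sF Cb T"
proof -
  interpret module_isometry sE Cb Cb sF Cb Cb T "inv_into Cb T"
    using assms by (intro module_isometry_inv_into Cb_module)
  interpret inv: module_isometry sF Cb Cb sE Cb Cb "inv_into Cb T" T by (rule inverse)
  have "\<exists>x. \<forall>\<phi>\<in>Cb. ev y \<phi> = \<phi> x" for y
    by (rule realcompact_character[OF X(2)])
      (simp_all add: ev_const ev_add ev_scale ev_abs Cb_ev_nonzero[OF module_isometry_axioms inf(2)])
  then obtain h where h: "\<And>y \<phi>. \<phi> \<in> Cb \<Longrightarrow> ev y \<phi> = \<phi> (h y)" by metis
  have "\<exists>y. \<forall>\<psi>\<in>Cb. inv.ev x \<psi> = \<psi> y" for x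
    by (rule realcompact_character[OF Y(2)])
      (simp_all add: inv.ev_const inv.ev_add inv.ev_scale inv.ev_abs Cb_ev_nonzero[OF inv.module_isometry_axioms inf(1)])
  then obtain g where g: "\<And>x \<psi>. \<psi> \<in> Cb \<Longrightarrow> inv.ev x \<psi> = \<psi> (g x)" by metis
  have "homeomorphism UNIV UNIV h g"
  proof (rule homeomorphism_UNIV_I)
    show "h (g x) = x" for x using h g realcompact_separates[OF X(2)] by (rule point_map_inverse)
    show "g (h y) = y" for y using g h realcompact_separates[OF Y(2)] by (rule inv.point_map_inverse)
    show "continuous_on UNIV h"
      using ev_mem by (intro completely_regular_continuous[OF X(1)]) (simp add: Cb_def flip: h)
    show "continuous_on UNIV g"
      using inv.ev_mem by (intro completely_regular_continuous[OF Y(1)]) (simp add: Cb_def flip: g)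
  qed
  moreover have "continuous_on UNIV (\<lambda>y. T (\<lambda>_. e) y)" for e
    using T_mem[OF dom.A_const[of e]] by (simp add: Cb_def)
  moreover have "(\<lambda>e. T (\<lambda>_. e) y) \<in> isoms sE sF" for y
    by (rule constant_isometry[OF h])
  moreover have "T f y = T (\<lambda>_. f (h y)) y" if "f \<in> Cb" for f y
    using T_eq_at_point[OF h that] .
  ultimately show ?thesis
    unfolding strong_BS_def by (intro exI[of _ "\<lambda>y e. T (\<lambda>_. e) y"] exI[of _ h] exI[of _ g]) blast
qed

section \<open>Complete metric spaces\<close>

text \<open>Truncated distances are 1-Lipschitz; they are the test functions for all metric
  arguments below.\<close>

lemma Cbu_min_infdist: "(\<lambda>x. min 1 (infdist x S)) \<in> Cbu"
proof (rule CbuI)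
  show "uniformly_continuous_on UNIV (\<lambda>x. min 1 (infdist x S))"
    unfolding uniformly_continuous_on_def
  proof (intro allI impI)
    fix \<epsilon> :: real assume "\<epsilon> > 0"
    have "dist (min 1 (infdist x' S)) (min 1 (infdist x S)) \<le> dist x' x" for x x'
      using infdist_triangle_abs[of x' S x] by (simp add: dist_real_def min_def abs_if split: if_splits)
    then show "\<exists>d>0. \<forall>x\<in>UNIV. \<forall>x'\<in>UNIV. dist x' x < d \<longrightarrow>
        dist (min 1 (infdist x' S)) (min 1 (infdist x S)) < \<epsilon>"
      using \<open>\<epsilon> > 0\<close> by (meson le_less_trans)
  qed
  show "norm (min 1 (infdist x S)) \<le> 1" for x by (simp add: infdist_nonneg)
qed

text \<open>Efremovich's lemma: by Ramsey's theorem, pairs \<open>a n, b n\<close> at distance at least \<open>\<epsilon>\<close>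
  can be thinned out such that the two sets \<open>{a n}\<close> and \<open>{b n}\<close> have positive distance.\<close>
lemma dist_tendsto_zero_if_Cbu:
  fixes a b :: "nat \<Rightarrow> 'a::metric_space"
  assumes lim: "\<And>\<phi>. \<phi> \<in> (Cbu :: ('a \<Rightarrow> real) set) \<Longrightarrow> (\<lambda>n. \<phi> (a n) - \<phi> (b n)) \<longlonglongrightarrow> 0"
  shows "(\<lambda>n. dist (a n) (b n)) \<longlonglongrightarrow> 0"
proof (rule ccontr)
  assume "\<not> ?thesis"
  then obtain \<epsilon> where \<epsilon>: "\<epsilon> > 0" "\<forall>N. \<exists>n\<ge>N. \<epsilon> \<le> dist (a n) (b n)"
    unfolding lim_sequentially by (force simp: not_less)
  define Z where "Z = {n. \<epsilon> \<le> dist (a n) (b n)}"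
  have "infinite Z" unfolding infinite_nat_iff_unbounded_le Z_def using \<epsilon>(2) by auto
  define near where "near = (\<lambda>i j. dist (a i) (b j) < \<epsilon>/4)"
  \<comment> \<open>The colour encodes two bits for a pair \<open>i < j\<close>: whether
    \<open>a i\<close> is near \<open>b j\<close>, and whether \<open>a j\<close> is near
    \<open>b i\<close>.\<close>
  define col where "col = (\<lambda>P. (if near (Min P) (Max P) then 1 else 0) + (if near (Max P) (Min P) then 2 else 0) :: nat)"
  obtain Y t where Y: "Y \<subseteq> Z" "infinite Y" and mono: "\<forall>x\<in>Y. \<forall>y\<in>Y. x \<noteq> y \<longrightarrow> col {x, y} = t"
  proof -
    have "\<forall>x\<in>Z. \<forall>y\<in>Z. x \<noteq> y \<longrightarrow> col {x, y} < 4" by (simp add: col_def)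
    from Ramsey2[OF \<open>infinite Z\<close> this] show ?thesis using that by blast
  qed
  have t: "near i j \<longleftrightarrow> t = 1 \<or> t = 3" "near j i \<longleftrightarrow> t = 2 \<or> t = 3" "t = 0 \<or> t = 1 \<or> t = 2 \<or> t = 3"
    if "i \<in> Y" "j \<in> Y" "i < j" for i j
  proof -
    have "i \<noteq> j" using that(3) by simp
    then have "col {i, j} = t" using mono[rule_format, OF that(1,2)] by simp
    then have "(if near i j then 1 else 0) + (if near j i then 2 else 0) = t"
      using that(3) by (simp add: col_def)
    then show "near i j \<longleftrightarrow> t = 1 \<or> t = 3" "near j i \<longleftrightarrow> t = 2 \<or> t = 3" "t = 0 \<or> t = 1 \<or> t = 2 \<or> t = 3"
      by (cases "near i j"; cases "near j i"; simp)+
  qed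
  obtain i where i: "i \<in> Y" using Y(2) by (metis finite.emptyI ex_in_conv)
  obtain j where j: "j \<in> Y" "i < j" using Y(2) infinite_nat_iff_unbounded by blast
  obtain k where k: "k \<in> Y" "j < k" using Y(2) infinite_nat_iff_unbounded by blast
  have "i < k" using j k by simp
  have far: "\<epsilon> \<le> dist (a j) (b j)" using j Y(1) by (auto simp: Z_def)
  \<comment> \<open>The chain \<open>a j\<close>, \<open>b k\<close>, \<open>a i\<close>,
    \<open>b j\<close> would have length below \<open>3 * \<epsilon>/4\<close>, against
    \<open>far\<close>. The other direction uses \<open>a j\<close>, \<open>b i\<close>,
    \<open>a k\<close>, \<open>b j\<close>, so both bits of the colour are zero.\<close>
  have "\<not> (near i j \<and> near i k \<and> near j k)"
    using far dist_triangle_le[of "a j" "b k" "b j" "3 * \<epsilon>/4"] dist_triangle[of "b k" "b j" "a i"] \<epsilon>(1)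
      dist_triangle[of "a j" "b j" "b k"]
    unfolding near_def by (auto simp: dist_commute)
  moreover have "\<not> (near j i \<and> near k i \<and> near k j)"
    using far dist_triangle[of "a j" "b j" "b i"] dist_triangle[of "b i" "b j" "a k"] \<epsilon>(1)
    unfolding near_def by (auto simp: dist_commute)
  ultimately have "t = 0"
    using t[OF i j(1) j(2)] t[OF j(1) k(1) k(2)] t[OF i k(1) \<open>i < k\<close>] by blast
  then have "\<not> near m n" if "m \<in> Y" "n \<in> Y" "m \<noteq> n" for m n
    using t(1)[of m n] t(2)[of n m] that by (cases m n rule: linorder_cases) simp_all
  then have apart: "\<epsilon>/4 \<le> dist (a m) (b n)" if "m \<in> Y" "n \<in> Y" for m n
    using that Y(1) \<epsilon>(1) by (cases "m = n") (force simp: near_def Z_def)+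
  define \<phi> where "\<phi> = (\<lambda>x. min 1 (infdist x (a ` Y)))"
  have "(\<lambda>n. \<phi> (a n) - \<phi> (b n)) \<longlonglongrightarrow> 0"
    unfolding \<phi>_def by (rule lim) (rule Cbu_min_infdist)
  moreover have "min 1 (\<epsilon>/4) > 0" using \<epsilon>(1) by simp
  ultimately obtain N where N: "\<And>n. n \<ge> N \<Longrightarrow> \<bar>\<phi> (a n) - \<phi> (b n)\<bar> < min 1 (\<epsilon>/4)"
    unfolding lim_sequentially dist_real_def by fastforce
  obtain n where n: "n \<in> Y" "n \<ge> N" using Y(2) infinite_nat_iff_unbounded_le by blast
  have "\<epsilon>/4 \<le> infdist (b n) (a ` Y)"
  proof -
    have "\<epsilon>/4 \<le> (INF z\<in>a ` Y. dist (b n) z)"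
      using n(1) apart[OF _ n(1)] by (intro cINF_greatest) (auto simp: dist_commute[of "b n"])
    then show ?thesis using n(1) by (auto simp: infdist_def)
  qed
  moreover have "\<phi> (a n) = 0" using n(1) by (simp add: \<phi>_def)
  ultimately show False using N[OF n(2)] by (auto simp: \<phi>_def min_def abs_if split: if_splits)
qed

text \<open>The sequential criterion reduces the claim to pairs of sequences, for which scalar test
  functions suffice by the preceding lemma.\<close>

lemma Cbu_uniformly_continuous:
  fixes h :: "'y::metric_space \<Rightarrow> 'x::metric_space"
  assumes "\<And>\<phi>. \<phi> \<in> (Cbu :: ('x \<Rightarrow> real) set) \<Longrightarrow> (\<lambda>y. \<phi> (h y)) \<in> Cbu"
  shows "uniformly_continuous_on UNIV h"
  unfolding uniformly_continuous_on_sequentially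
proof (intro allI impI, elim conjE)
  fix a b :: "nat \<Rightarrow> 'y"
  assume ab: "(\<lambda>n. dist (a n) (b n)) \<longlonglongrightarrow> 0"
  show "(\<lambda>n. dist (h (a n)) (h (b n))) \<longlonglongrightarrow> 0"
  proof (rule dist_tendsto_zero_if_Cbu)
    fix \<phi> :: "'x \<Rightarrow> real" assume "\<phi> \<in> Cbu"
    then have "uniformly_continuous_on UNIV (\<lambda>y. \<phi> (h y))" using assms by (simp add: Cbu_def)
    then have "(\<lambda>n. dist (\<phi> (h (a n))) (\<phi> (h (b n)))) \<longlonglongrightarrow> 0"
      using ab unfolding uniformly_continuous_on_sequentially by blast
    then show "(\<lambda>n. \<phi> (h (a n)) - \<phi> (h (b n))) \<longlonglongrightarrow> 0"
      unfolding dist_norm by (rule tendsto_norm_zero_cancel)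
  qed
qed

text \<open>If the sequence were not Cauchy, two index sequences tending to infinity would keep its
  values a fixed distance apart, while every test function has the same limit along both.\<close>

lemma Cbu_limit_point:
  fixes x :: "nat \<Rightarrow> 'a::complete_space"
  assumes lim: "\<And>\<phi>. \<phi> \<in> (Cbu :: ('a \<Rightarrow> real) set) \<Longrightarrow> (\<lambda>n. \<phi> (x n)) \<longlonglongrightarrow> L \<phi>"
  shows "\<exists>z. \<forall>\<phi>\<in>Cbu. L \<phi> = \<phi> z"
proof -
  have "Cauchy x"
  proof (rule ccontr)
    assume "\<not> Cauchy x"
    then obtain \<epsilon> where \<epsilon>: "\<epsilon> > 0" "\<forall>N. \<exists>m\<ge>N. \<exists>n\<ge>N. \<epsilon> \<le> dist (x m) (x n)"
      unfolding Cauchy_def by (auto simp: not_less)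
    then obtain m n where mn: "\<And>N. m N \<ge> N" "\<And>N. n N \<ge> N" "\<And>N. \<epsilon> \<le> dist (x (m N)) (x (n N))"
      by metis
    have "filterlim m at_top sequentially" "filterlim n at_top sequentially"
      using mn by (auto intro: filterlim_at_top_mono[OF filterlim_ident])
    then have "(\<lambda>N. \<phi> (x (m N)) - \<phi> (x (n N))) \<longlonglongrightarrow> L \<phi> - L \<phi>" if "\<phi> \<in> Cbu" for \<phi>
      by (intro tendsto_diff filterlim_compose[OF lim[OF that]])
    then have "(\<lambda>N. dist (x (m N)) (x (n N))) \<longlonglongrightarrow> 0"
      by (intro dist_tendsto_zero_if_Cbu) simp
    then have "\<epsilon> \<le> 0" using mn(3) by (intro LIMSEQ_le_const) auto
    then show False using \<epsilon>(1) by simp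
  qed
  then obtain z where z: "x \<longlonglongrightarrow> z" using Cauchy_convergent convergent_def by blast
  have "L \<phi> = \<phi> z" if "\<phi> \<in> Cbu" for \<phi>
  proof -
    have "continuous_on UNIV \<phi>"
      using that by (auto simp: Cbu_def intro: uniformly_continuous_imp_continuous)
    then have "(\<lambda>n. \<phi> (x n)) \<longlonglongrightarrow> \<phi> z"
      using z by (auto intro: continuous_on_tendsto_compose)
    then show ?thesis using lim[OF that] LIMSEQ_unique by blast
  qed
  then show ?thesis by blast
qed

text \<open>The function \<open>\<psi> = min 1 (dist y)\<close> governs every function of \<open>Cbu\<close> near \<open>y\<close>; hence its
  transform \<open>u\<close> governs every function on the other side near the ideal point attached to
  \<open>y\<close>, which is thus the limit of any sequence along which \<open>u\<close> tends to \<open>0\<close>.\<close>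
lemma Cbu_ev_point:
  fixes T :: "('x::complete_space \<Rightarrow> 'e::banach) \<Rightarrow> ('y::metric_space \<Rightarrow> 'f::banach)"
  assumes iso: "module_isometry sE Cbu Cbu sF Cbu Cbu T T'"
  shows "\<exists>x. \<forall>\<phi>\<in>Cbu. module_isometry.ev Cbu T y \<phi> = \<phi> x"
proof -
  interpret module_isometry sE Cbu Cbu sF Cbu Cbu T T' by (rule iso)
  interpret inv: module_isometry sF Cbu Cbu sE Cbu Cbu T' T by (rule inverse)
  define \<psi> where "\<psi> = (\<lambda>z::'y. min 1 (infdist z {y}))"
  have \<psi>: "\<psi> \<in> Cbu" unfolding \<psi>_def by (rule Cbu_min_infdist)
  have \<psi>_nonneg: "\<psi> z \<ge> 0" for z by (simp add: \<psi>_def infdist_nonneg)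
  define u where "u = (\<lambda>x. inv.ev x \<psi>)"
  have u: "u \<in> Cbu" unfolding u_def by (rule inv.ev_mem[OF \<psi>])
  have u_nonneg: "u x \<ge> 0" for x unfolding u_def by (rule inv.ev_nonneg[OF \<psi> \<psi>_nonneg])
  \<comment> \<open>Hence \<open>u\<close> has no positive lower bound: such a bound would survive
    \<open>ev y\<close>.\<close>
  have "ev y u = \<psi> y" unfolding u_def by (rule inv.ev_ev_inverse[OF \<psi>])
  then have ev_u: "ev y u = 0" by (simp add: \<psi>_def)
  have "\<exists>x. u x < inverse (real (Suc n))" for n
  proof (rule ccontr)
    assume "\<not> ?thesis"
    then have "ev y (\<lambda>_. inverse (real (Suc n))) \<le> ev y u"
      by (intro ev_mono u dom.R_const) (simp add: not_less)
    then show False using ev_u by (simp add: ev_const)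
  qed
  then obtain x where x: "\<And>n. u (x n) < inverse (real (Suc n))" by metis
  have ux: "(\<lambda>n. u (x n)) \<longlonglongrightarrow> 0"
    by (rule tendsto_sandwich[OF _ _ tendsto_const LIMSEQ_inverse_real_of_nat])
      (intro always_eventually allI u_nonneg less_imp_le[OF x])+
  show ?thesis
  proof (rule Cbu_limit_point)
    fix \<phi> :: "'x \<Rightarrow> real" assume \<phi>: "\<phi> \<in> Cbu"
    define \<theta> where "\<theta> = (\<lambda>z. ev z \<phi>)"
    have \<theta>: "\<theta> \<in> Cbu" unfolding \<theta>_def by (rule ev_mem[OF \<phi>])
    have d: "(\<lambda>z. \<theta> z - \<theta> y) \<in> Cbu" by (intro cod.R_diff \<theta> cod.R_const)
    obtain M where M: "M > 0" "\<And>z. \<bar>\<theta> z - \<theta> y\<bar> \<le> M" using cod.R_bound[OF d] by blast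
    have inv\<theta>: "inv.ev z (\<lambda>w. \<bar>\<theta> w - \<theta> y\<bar>) = \<bar>\<phi> z - ev y \<phi>\<bar>" for z
      by (simp add: inv.ev_abs d inv.ev_diff \<theta> cod.R_const inv.ev_const)
        (simp add: \<theta>_def ev_ev_inverse \<phi>)
    show "(\<lambda>n. \<phi> (x n)) \<longlonglongrightarrow> ev y \<phi>"
    proof (rule metric_LIMSEQ_I)
      fix \<epsilon> :: real assume \<epsilon>: "\<epsilon> > 0"
      have "uniformly_continuous_on UNIV \<theta>" using \<theta> by (simp add: Cbu_def)
      then obtain \<delta> where \<delta>: "\<delta> > 0" "\<And>z. dist z y < \<delta> \<Longrightarrow> \<bar>\<theta> z - \<theta> y\<bar> < \<epsilon>/2"
        unfolding uniformly_continuous_on_def dist_real_def using \<epsilon> by (metis UNIV_I half_gt_zero)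
      \<comment> \<open>Since \<psi> is truncated at 1, only a threshold of at most 1 lets
        \<open>\<psi> z < \<eta>\<close> bound the distance itself.\<close>
      define \<eta> where "\<eta> = min 1 \<delta>"
      have \<eta>: "\<eta> > 0" using \<delta>(1) by (simp add: \<eta>_def)
      \<comment> \<open>Near \<open>y\<close> continuity suffices; away from \<open>y\<close> the
        term with \<psi> exceeds \<open>M\<close>. Transforming this inequality replaces \<theta> by
        \<phi> and \<psi> by \<open>u\<close>.\<close>
      have "\<bar>\<theta> z - \<theta> y\<bar> \<le> \<epsilon>/2 + (M/\<eta>) * \<psi> z" for z
      proof (cases "\<psi> z < \<eta>")
        case True
        then have "dist z y < \<delta>" by (auto simp: \<psi>_def \<eta>_def infdist_def min_def split: if_splits)
        then show ?thesis using \<delta>(2)[of z] M(1) \<eta> \<psi>_nonneg[of z] by (simp add: add_increasing2 less_imp_le)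
      next
        case False
        then have "M \<le> (M/\<eta>) * \<psi> z" using M(1) \<eta> by (simp add: field_simps)
        then show ?thesis using M(2)[of z] \<epsilon> by simp
      qed
      then have "inv.ev z (\<lambda>w. \<bar>\<theta> w - \<theta> y\<bar>) \<le> inv.ev z (\<lambda>w. \<epsilon>/2 + (M/\<eta>) * \<psi> w)" for z
        by (intro inv.ev_mono cod.R_abs d cod.R_add cod.R_const cod.R_scale \<psi>)
      then have bound: "\<bar>\<phi> z - ev y \<phi>\<bar> \<le> \<epsilon>/2 + (M/\<eta>) * u z" for z
        by (simp only: inv\<theta> inv.ev_add[OF cod.R_const cod.R_scale[OF \<psi>]] inv.ev_scale[OF \<psi>] inv.ev_const u_def)
      have "\<eta> * \<epsilon> / (2 * M) > 0" using \<eta> \<epsilon> M(1) by simp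
      then obtain N where N: "\<And>n. n \<ge> N \<Longrightarrow> u (x n) < \<eta> * \<epsilon> / (2 * M)"
        using ux u_nonneg unfolding lim_sequentially dist_real_def by fastforce
      have "dist (\<phi> (x n)) (ev y \<phi>) < \<epsilon>" if "n \<ge> N" for n
      proof -
        have "(M/\<eta>) * u (x n) < (M/\<eta>) * (\<eta> * \<epsilon> / (2 * M))"
          using N[OF that] M(1) \<eta> by (intro mult_strict_left_mono) auto
        also have "\<dots> = \<epsilon>/2" using M(1) \<eta> by simp
        finally show ?thesis using bound[of "x n"] unfolding dist_real_def by linarith
      qed
      then show "\<exists>N. \<forall>n\<ge>N. dist (\<phi> (x n)) (ev y \<phi>) < \<epsilon>" by blast
    qed
  qed
qed

lemma Cbu_separates:
  fixes x x' :: "'a::metric_space"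
  assumes "\<And>\<phi>. \<phi> \<in> (Cbu :: ('a \<Rightarrow> real) set) \<Longrightarrow> \<phi> x = \<phi> x'"
  shows "x = x'"
  using assms[OF Cbu_min_infdist[of "{x}"]] by (auto simp: infdist_def min_def dist_commute split: if_splits)

theorem Cbu_uniform_strong_BS:
  fixes T :: "('x::complete_space \<Rightarrow> 'e::banach) \<Rightarrow> ('y::complete_space \<Rightarrow> 'f::banach)"
  assumes "kbanach sE" "kbanach sF" "one_dim_centralizer sE" "one_dim_centralizer sF"
    and T: "surj_lin_isom sE sF Cbu Cbu T"
  shows "uniform_strong_BS sE sF Cbu T"
proof -
  interpret module_isometry sE Cbu Cbu sF Cbu Cbu T "inv_into Cbu T"
    using assms by (intro module_isometry_inv_into Cbu_module)
  interpret inv: module_isometry sF Cbu Cbu sE Cbu Cbu "inv_into Cbu T" T by (rule inverse)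
  obtain h where h: "\<And>y \<phi>. \<phi> \<in> Cbu \<Longrightarrow> ev y \<phi> = \<phi> (h y)"
    using Cbu_ev_point[OF module_isometry_axioms] by metis
  obtain g where g: "\<And>x \<psi>. \<psi> \<in> Cbu \<Longrightarrow> inv.ev x \<psi> = \<psi> (g x)"
    using Cbu_ev_point[OF inv.module_isometry_axioms] by metis
  have uc: "uniformly_continuous_on UNIV h" "uniformly_continuous_on UNIV g"
    using ev_mem inv.ev_mem by (auto intro!: Cbu_uniformly_continuous simp flip: h g)
  have "homeomorphism UNIV UNIV h g"
  proof (rule homeomorphism_UNIV_I)
    show "h (g x) = x" for x using h g Cbu_separates by (rule point_map_inverse)
    show "g (h y) = y" for y using g h Cbu_separates by (rule inv.point_map_inverse)
  qed (use uc in \<open>auto intro: uniformly_continuous_imp_continuous\<close>)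
  moreover have "continuous_on UNIV (\<lambda>y. T (\<lambda>_. e) y)" for e
    using T_mem[OF dom.A_const[of e]] by (auto simp: Cbu_def intro: uniformly_continuous_imp_continuous)
  moreover have "(\<lambda>e. T (\<lambda>_. e) y) \<in> isoms sE sF" for y
    by (rule constant_isometry[OF h])
  moreover have "T f y = T (\<lambda>_. f (h y)) y" if "f \<in> Cbu" for f y
    using T_eq_at_point[OF h that] .
  ultimately show ?thesis
    unfolding uniform_strong_BS_def using uc
    by (intro exI[of _ "\<lambda>y e. T (\<lambda>_. e) y"] exI[of _ h] exI[of _ g]) blast
qed

theorem theorem3p6:
  fixes sE :: "'k::{real_normed_field,banach} \<Rightarrow> 'e::banach \<Rightarrow> 'e"
    and sF :: "'k \<Rightarrow> 'f::banach \<Rightarrow> 'f"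
  assumes "kbanach sE" and "kbanach sF"
    and "one_dim_centralizer sE" and "one_dim_centralizer sF"
  shows "(\<forall>T::('a::topological_space \<Rightarrow> 'e) \<Rightarrow> ('b::topological_space \<Rightarrow> 'f).
            completely_regular_space (euclidean :: 'a topology) \<and> realcompact (euclidean :: 'a topology) \<and>
            completely_regular_space (euclidean :: 'b topology) \<and> realcompact (euclidean :: 'b topology) \<and>
            infinite_dim sE \<and> infinite_dim sF \<and> surj_lin_isom sE sF Cb Cb T
            \<longrightarrow> strong_BS sE sF Cb T)
       \<and> (\<forall>T::('c::complete_space \<Rightarrow> 'e) \<Rightarrow> ('d::complete_space \<Rightarrow> 'f).
            surj_lin_isom sE sF Cbu Cbu T \<longrightarrow> uniform_strong_BS sE sF Cbu T)"
  using Cb_strong_BS[OF assms] Cbu_uniform_strong_BS[OF assms] by blast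

end
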